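(* Let $p$ be a prime, let $r$ be a positive odd integer, and let $q=p^r$ or $q=(-p)^r$ (so $q$ may be negative). Let $t\ge 1$ be an integer, let $\zeta_{4t}$ be a primitive $4t$-th root of unity, fix a square root $\sqrt q\in\mathbb{C}$ of $q$, and let $\theta=\sqrt{q}\,\zeta_{4t}$. (1) (Normal case) Suppose that either (a) $q$ is odd and at least one of the following holds: (i) $t$ is even; (ii) $p\nmid t$; (iii) $q\equiv 1 \pmod 4$; or (b) $q$ is even and $t\not\equiv 2\pmod 4$. Then the minimal polynomial of $\theta$ over $\mathbb{Q}$ is $\Phi_{4t}^{[\sqrt{q}]}(X)$. (2) (Exceptional case) (a) If $q\equiv 3\pmod 4$, $p\mid t$ and $t$ is odd, then the minimal polynomial of $\theta$ over $\mathbb{Q}$ is $\Psi_{p,t/p}^{[\sqrt{q^{*}}]}(X)$, where $q^*=-q$, and where the primitive $t$-th root of unity $\zeta_t$ used to define $\Psi_{p,t/p}$ and the square root $\sqrt{q^*}$ are chosen so that $\theta=\sqrt{q^*}\,\zeta_t$. (b) If $q>0$ is even and $t=2s\equiv 2\pmod 4$, then the minimal polynomial of $\theta$ over $\mathbb{Q}$ is $\Psi_{2,s}^{[\sqrt{q}]}(X)$. (c) If $q<0$ is even and $t=2s\equiv 2\pmod 4$, then the minimal polynomial of $\theta$ over $\mathbb{Q}$ is $\Psi_{-2,s}^{[\sqrt{q}]}(X)$. In (b) and (c), the primitive 8th root of unity $\zeta_8$ and the primitive $s$-th root of unity $\zeta_s$ used to define $\Psi_{\pm 2,s}$ are chosen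 so that $\zeta_{4t}=\zeta_8\zeta_s$.
   Context: $\Phi_m(X)$ is the $m$-th cyclotomic polynomial. $U(\mathbb{Z}/m\mathbb{Z})$ is the multiplicative group of units modulo $m$, and $\left(\frac{a}{p}\right)$ is the Legendre symbol. For a field $K$, $f(X)\in K[X]$ and $a\in K^\times$, put $f^{[a]}(X):=a^{\deg f}f(X/a)$. For an odd prime $p$ and an odd positive integer $t$, with $\zeta_{pt}$ a primitive $pt$-th root of unity, $$\Psi_{p,t}(X):=\prod_{a\in U(\mathbb{Z}/pt\mathbb{Z})}\left(X-\left(\tfrac{a}{p}\right)\zeta_{pt}^{a}\right).$$ For an odd positive integer $t$, with $\zeta_8$ a primitive 8th root of unity and $\zeta_t$ a primitive $t$-th root of unity, $$\Psi_{2,t}(X):=\prod_{a\in U(\mathbb{Z}/t\mathbb{Z})}(X-\zeta_8\zeta_t^a)(X-\zeta_8^{-1}\zeta_t^a),\qquad \Psi_{-2,t}(X):=\prod_{a\in U(\mathbb{Z}/t\mathbb{Z})}(X-\zeta_8\zeta_t^a)(X-\zeta_8^{3}\zeta_t^a).$$ These polynomials depend on the choice of the roots of unity up to replacing $\Psi(X)$ by $\Psi(-X)$. *)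

theory Defs
  imports
    Complex_Main
    "HOL-Computational_Algebra.Polynomial"
    "HOL-Number_Theory.Number_Theory"
begin

(* HOL-Algebra, imported through HOL-Number_Theory, shadows these polynomial constants. *)
hide_const (open) up_ring.coeff up_ring.monom Module.smult

definition primitive_root_unity :: "nat \<Rightarrow> complex \<Rightarrow> bool" where
  "primitive_root_unity m z \<longleftrightarrow> m > 0 \<and> z ^ m = 1 \<and> (\<forall>k. 0 < k \<and> k < m \<longrightarrow> z ^ k \<noteq> 1)"

(* As with the library constants algebraic and algebraic_int, a polynomial over the rationals is
   a complex polynomial all of whose coefficients are rational. *)
definition is_min_poly_rat :: "complex poly \<Rightarrow> complex \<Rightarrow> bool" where
  "is_min_poly_rat f x \<longleftrightarrow>
     (\<forall>i. coeff f i \<in> \<rat>) \<and> lead_coeff f = 1 \<and> poly f x = 0 \<and>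
     (\<forall>g. (\<forall>i. coeff g i \<in> \<rat>) \<and> g \<noteq> 0 \<and> poly g x = 0 \<longrightarrow> degree f \<le> degree g)"

definition cyclotomic_poly :: "nat \<Rightarrow> complex poly" where
  "cyclotomic_poly m = (\<Prod>z | primitive_root_unity m z. [:- z, 1:])"

(* f^[a](X) = a^(deg f) f(X/a), for nonzero a *)
definition scale_poly :: "complex \<Rightarrow> complex poly \<Rightarrow> complex poly" where
  "scale_poly a f = smult (a ^ degree f) (pcompose f [:0, 1 / a:])"

(* The roots of unity are explicit arguments: z is the primitive (p * t)-th root of unity in
   Psi_odd, while z8 and z are the primitive 8-th and t-th roots of unity in Psi_two and
   Psi_minus_two. The library constant totatives m is the set of representatives in {1..m}
   of the units modulo m. *)
definition Psi_odd :: "nat \<Rightarrow> nat \<Rightarrow> complex \<Rightarrow> complex poly" where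
  "Psi_odd p t z =
     (\<Prod>a\<in>totatives (p * t). [:- (of_int (Legendre (int a) (int p)) * z ^ a), 1:])"

definition Psi_two :: "nat \<Rightarrow> complex \<Rightarrow> complex \<Rightarrow> complex poly" where
  "Psi_two t z8 z = (\<Prod>a\<in>totatives t. [:- (z8 * z ^ a), 1:] * [:- (inverse z8 * z ^ a), 1:])"

definition Psi_minus_two :: "nat \<Rightarrow> complex \<Rightarrow> complex \<Rightarrow> complex poly" where
  "Psi_minus_two t z8 z = (\<Prod>a\<in>totatives t. [:- (z8 * z ^ a), 1:] * [:- (z8 ^ 3 * z ^ a), 1:])"

end

theory Submission
  imports Defs "HOL-Computational_Algebra.Computational_Algebra"
begin

text \<open>
  Call \<open>y\<close> a rational conjugate of \<open>x\<close> when every rational polynomial that vanishes at \<open>x\<close> also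
  vanishes at \<open>y\<close>.  If \<open>x\<close> has only finitely many rational conjugates, then its minimal polynomial
  is the product of the linear factors belonging to them (\<open>is_min_poly_rat_prod_conjugates\<close>).  Each
  polynomial of the theorem is written as a product of distinct linear factors, so the theorem
  amounts to computing the set of conjugates of \<open>\<theta> = \<surd>q \<zeta>\<close> in each case; the rationality of the
  coefficients comes with it.

  The arithmetic input is the irreducibility of the cyclotomic polynomials, in the form that all
  primitive \<open>n\<close>-th roots of unity are conjugate (\<open>rational_conjugate_primitive_roots\<close>).  This reduces
  to \<open>x\<close> and \<open>x\<^sup>p\<close> for an \<open>n\<close>-th root of unity \<open>x\<close> and a prime \<open>p\<close> not dividing \<open>n\<close>.  If the
  primitive integer polynomial \<open>g\<close> of least degree with root \<open>x\<close> did not vanish at \<open>x\<^sup>p\<close>,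
  differentiating \<open>X\<^sup>n - 1 = g k\<close> would show that \<open>g(x\<^sup>p)\<close> divides \<open>n\<close> in \<open>\<int>[x]\<close>; but \<open>g(x\<^sup>p)\<close> is
  congruent to \<open>g(x)\<^sup>p = 0\<close> modulo \<open>p\<close>, and so \<open>p\<close> would divide \<open>n\<close>.

  In the normal case the roots of the scaled cyclotomic polynomial are the numbers \<open>y\<close> for which \<open>y\<^sup>2 / q\<close> is a primitive
  \<open>2t\<close>-th root of unity.  All conjugates of \<open>\<theta>\<close> have this property, and conversely all such \<open>y\<close> are
  conjugates as soon as \<open>-\<theta>\<close> is one (\<open>rational_conjugates_sqrt_times_root\<close>).  To see that \<open>-\<theta>\<close> is a
  conjugate one writes \<open>\<surd>q\<close> as a polynomial in roots of unity, through a Gauss sum for odd \<open>p\<close> and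
  through \<open>z\<^sub>8 + z\<^sub>8\<^sup>7 = \<plusminus>\<surd>2\<close>, \<open>z\<^sub>8 + z\<^sub>8\<^sup>3 = \<plusminus>\<surd>-2\<close> for \<open>p = 2\<close>, and looks for a substitution of roots
  of unity that changes the sign of the product.  When \<open>\<surd>q\<close> is an even polynomial in \<open>\<zeta>\<close>, the
  substitution \<open>\<zeta> \<mapsto> -\<zeta>\<close> does; when \<open>\<surd>q\<close> is not in the field of \<open>\<zeta>\<close>, one fixes \<open>\<zeta>\<close> and changes the
  sign of \<open>\<surd>q\<close>.

  In the exceptional cases \<open>\<theta>\<close> generates a cyclotomic field: a primitive root of unity \<open>w\<close>, of order
  \<open>t\<close> or \<open>2t\<close>, is a polynomial in \<open>\<theta>\<^sup>2\<close>, and \<open>\<theta> = f(w)\<close> for a rational polynomial \<open>f\<close>.  Then the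
  conjugates of \<open>\<theta>\<close> are the values of \<open>f\<close> at the primitive roots of that order
  (\<open>rational_conjugates_cyclotomic_generator\<close>).  The factors of \<open>\<Psi>\<close> come from the action on \<open>\<surd>q\<close>: the
  Gauss sum is multiplied by a Legendre symbol, and for \<open>p = 2\<close> the product of \<open>\<surd>q\<close> with \<open>z\<^sub>8\<close> is
  interchanged with the product of \<open>\<surd>q\<close> with the other eighth root, \<open>z\<^sub>8\<^sup>7\<close> or \<open>z\<^sub>8\<^sup>3\<close>.
\<close>

section \<open>Rational conjugates\<close>

lemma poly_map_poly_add:
  fixes f :: "'a::comm_ring_1 \<Rightarrow> 'b::comm_ring_1"
  assumes "f 0 = 0" and "\<And>a b. f (a + b) = f a + f b"
  shows "poly (map_poly f (p + q)) x = poly (map_poly f p) x + poly (map_poly f q) x"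
proof -
  have "map_poly f (p + q) = map_poly f p + map_poly f q"
    by (rule poly_eqI) (simp add: coeff_map_poly assms)
  then show ?thesis by simp
qed

lemma poly_map_poly_mult:
  fixes f :: "'a::comm_ring_1 \<Rightarrow> 'b::comm_ring_1"
  assumes "f 0 = 0" and add: "\<And>a b. f (a + b) = f a + f b" and "\<And>a b. f (a * b) = f a * f b"
  shows "poly (map_poly f (p * q)) x = poly (map_poly f p) x * poly (map_poly f q) x"
proof (induction p)
  case (pCons a p)
  have "poly (map_poly f (pCons a p * q)) x
      = poly (map_poly f (smult a q)) x + poly (map_poly f (pCons 0 (p * q))) x"
    by (simp add: poly_map_poly_add assms)
  also have "\<dots> = poly (map_poly f (pCons a p)) x * poly (map_poly f q) x"
    using pCons.IH by (simp add: map_poly_smult map_poly_pCons assms algebra_simps)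
  finally show ?case .
qed (simp add: assms)

definition rat_eval :: "rat poly \<Rightarrow> complex \<Rightarrow> complex" where
  "rat_eval h x = poly (map_poly of_rat h) x"

lemma rat_eval_simps [simp]:
  "rat_eval 0 x = 0"
  "rat_eval 1 x = 1"
  "rat_eval (pCons c h) x = of_rat c + x * rat_eval h x"
  "rat_eval (g + h) x = rat_eval g x + rat_eval h x"
  "rat_eval (g * h) x = rat_eval g x * rat_eval h x"
  by (simp_all add: rat_eval_def map_poly_pCons poly_map_poly_add poly_map_poly_mult
      of_rat_add of_rat_mult)

lemma rat_eval_pcompose [simp]: "rat_eval (pcompose g h) x = rat_eval g (rat_eval h x)"
  by (induction g) (simp_all add: pcompose_pCons)

text \<open>
  For algebraic \<open>x\<close> this is conjugacy over the rationals.  A transcendental \<open>x\<close> has every complex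
  number as a conjugate, so that finiteness of the set of conjugates already makes \<open>x\<close> algebraic.
\<close>

definition rational_conjugate :: "complex \<Rightarrow> complex \<Rightarrow> bool" where
  "rational_conjugate x y \<longleftrightarrow> (\<forall>h. rat_eval h x = 0 \<longrightarrow> rat_eval h y = 0)"

lemma rational_conjugateD: "rational_conjugate x y \<Longrightarrow> rat_eval h x = 0 \<Longrightarrow> rat_eval h y = 0"
  by (simp add: rational_conjugate_def)

lemma rational_conjugate_refl [simp]: "rational_conjugate x x"
  by (simp add: rational_conjugate_def)

lemma rational_conjugate_trans:
  "rational_conjugate x y \<Longrightarrow> rational_conjugate y z \<Longrightarrow> rational_conjugate x z"
  by (simp add: rational_conjugate_def)

text \<open>
  Division with remainder by a polynomial of least degree.
\<close>

lemma exists_minimal_rational_poly: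
  assumes "rat_eval h x = 0" and "h \<noteq> 0"
  obtains m where "lead_coeff m = 1" and "rat_eval m x = 0"
    and "\<And>g. rat_eval g x = 0 \<Longrightarrow> m dvd g"
proof -
  define P where "P = (\<lambda>g. g \<noteq> 0 \<and> rat_eval g x = 0)"
  define g where "g = arg_min degree P"
  have "P h" using assms by (simp add: P_def)
  then have Pg: "P g" and least: "\<And>f. P f \<Longrightarrow> degree g \<le> degree f"
    unfolding g_def by (auto intro: arg_min_natI arg_min_nat_le)
  define m where "m = smult (inverse (lead_coeff g)) g"
  have m_eq: "m = [:inverse (lead_coeff g):] * g" by (simp add: m_def)
  have lead: "lead_coeff m = 1" and deg: "degree m = degree g"
    using Pg by (simp_all add: m_def P_def)
  have root: "rat_eval m x = 0"
    using Pg unfolding m_eq P_def rat_eval_simps by simp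
  have "m dvd f" if "rat_eval f x = 0" for f
  proof (rule ccontr)
    assume "\<not> m dvd f"
    moreover have "m \<noteq> 0" using lead by auto
    ultimately have lt: "degree (f mod m) < degree m" and nz: "f mod m \<noteq> 0"
      by (simp_all add: degree_mod_less_degree mod_eq_0_iff_dvd)
    have "rat_eval f x = rat_eval (f div m * m + f mod m) x" by simp
    then have "rat_eval (f mod m) x = 0"
      unfolding rat_eval_simps using that root by simp
    then have "P (f mod m)" using nz by (simp add: P_def)
    then show False using least lt deg by fastforce
  qed
  with that lead root show thesis by blast
qed

text \<open>
  The minimal polynomial \<open>m\<close> of \<open>x\<close> vanishes at \<open>y\<close> and is therefore a multiple \<open>n k\<close> of the minimal
  polynomial \<open>n\<close> of \<open>y\<close>.  The cofactor \<open>k\<close> has smaller degree than \<open>m\<close>, so it does not vanish at \<open>x\<close>,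
  and \<open>n\<close> must.
\<close>

lemma rational_conjugate_sym:
  assumes xy: "rational_conjugate x y" and alg: "rat_eval h x = 0" "h \<noteq> 0"
  shows "rational_conjugate y x"
proof -
  obtain m where m: "lead_coeff m = 1" "rat_eval m x = 0" "\<And>g. rat_eval g x = 0 \<Longrightarrow> m dvd g"
    using exists_minimal_rational_poly[OF alg] by blast
  have m0: "m \<noteq> 0" using m(1) by auto
  have my: "rat_eval m y = 0" using rational_conjugateD[OF xy m(2)] .
  obtain n where n: "lead_coeff n = 1" "rat_eval n y = 0" "\<And>g. rat_eval g y = 0 \<Longrightarrow> n dvd g"
    using exists_minimal_rational_poly[OF my m0] by blast
  obtain k where k: "m = n * k" using n(3)[OF my] by (blast elim: dvdE)
  have nz: "n \<noteq> 0" "k \<noteq> 0" using k m0 by auto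
  have "degree n \<noteq> 0"
  proof
    assume "degree n = 0"
    then obtain c where "n = [:c:]" by (rule degree_eq_zeroE)
    with n(1,2) show False by simp
  qed
  then have "degree k < degree m" using nz by (simp add: k degree_mult_eq)
  then have "\<not> m dvd k" using nz(2) dvd_imp_degree_le[of m k] by linarith
  then have "rat_eval k x \<noteq> 0" using m(3) by blast
  then have nx: "rat_eval n x = 0" using m(2) by (simp add: k)
  show ?thesis
    unfolding rational_conjugate_def
  proof (intro allI impI)
    fix g assume "rat_eval g y = 0"
    then obtain l where "g = n * l" using n(3) by (blast elim: dvdE)
    with nx show "rat_eval g x = 0" by simp
  qed
qed

lemma rational_coeffs_imp_map_poly_of_rat:
  assumes "\<forall>i. coeff g i \<in> \<rat>"
  obtains h where "map_poly of_rat h = (g :: complex poly)"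
proof
  define r where "r = (\<lambda>c :: complex. SOME q. c = of_rat q)"
  have r: "of_rat (r c) = c" if "c \<in> \<rat>" for c
    using that unfolding r_def by (metis (mono_tags, lifting) Rats_cases someI_ex)
  have "r 0 = 0" using r[of 0] by (metis Rats_0 of_rat_eq_0_iff)
  then show "map_poly of_rat (map_poly r g) = g"
    using assms by (intro poly_eqI) (simp add: coeff_map_poly r)
qed

text \<open>
  The roots of the minimal polynomial \<open>m\<close> are exactly the conjugates of \<open>x\<close>.  They are simple: a root
  shared with the derivative would, by symmetry of conjugacy, make the derivative vanish at \<open>x\<close>,
  although its degree is smaller than that of \<open>m\<close>.
\<close>

lemma is_min_poly_rat_prod_conjugates:
  assumes "finite {y. rational_conjugate x y}"
  shows "is_min_poly_rat (\<Prod>y | rational_conjugate x y. [:- y, 1:]) x"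
proof -
  have "\<exists>h. rat_eval h x = 0 \<and> h \<noteq> 0"
  proof (rule ccontr)
    assume "\<nexists>h. rat_eval h x = 0 \<and> h \<noteq> 0"
    then have "rational_conjugate x y" for y
      unfolding rational_conjugate_def by (metis rat_eval_simps(1))
    with assms show False using infinite_UNIV_char_0[where 'a = complex] by simp
  qed
  then obtain m where m: "lead_coeff m = 1" "rat_eval m x = 0"
      "\<And>g. rat_eval g x = 0 \<Longrightarrow> m dvd g"
    using exists_minimal_rational_poly by metis
  have m0: "m \<noteq> 0" using m(1) by auto
  have roots: "rat_eval m y = 0 \<longleftrightarrow> rational_conjugate x y" for y
  proof
    assume my: "rat_eval m y = 0"
    show "rational_conjugate x y"
      unfolding rational_conjugate_def
    proof (intro allI impI)
      fix g assume "rat_eval g x = 0"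
      then obtain k where "g = m * k" using m(3) by (blast elim: dvdE)
      with my show "rat_eval g y = 0" by simp
    qed
  qed (use rational_conjugateD m(2) in blast)
  define M where "M = map_poly (of_rat :: rat \<Rightarrow> complex) m"
  have degM: "degree M = degree m" by (simp add: M_def degree_map_poly)
  have leadM: "lead_coeff M = 1"
    using m(1) by (simp add: M_def degree_map_poly coeff_map_poly)
  have evM: "poly M y = rat_eval m y" for y by (simp add: M_def rat_eval_def)
  have derivM: "poly (pderiv M) y = rat_eval (pderiv m) y" for y
    unfolding M_def rat_eval_def
    by (rule arg_cong[where f = "\<lambda>p. poly p y"], rule poly_eqI)
       (simp add: coeff_map_poly coeff_pderiv of_rat_mult of_rat_add)
  have "rat_eval (pderiv m) x \<noteq> 0"
  proof
    assume "rat_eval (pderiv m) x = 0"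
    then have dvd: "m dvd pderiv m" by (rule m(3))
    have "degree m \<noteq> 0"
    proof
      assume "degree m = 0"
      then obtain c where "m = [:c:]" by (rule degree_eq_zeroE)
      with m(1,2) show False by simp
    qed
    then have "pderiv m \<noteq> 0" "degree (pderiv m) < degree m"
      by (auto simp: pderiv_eq_0_iff degree_pderiv)
    with dvd_imp_degree_le[OF dvd] show False by simp
  qed
  then have simple: "rat_eval (pderiv m) y \<noteq> 0" if "rational_conjugate x y" for y
    using rational_conjugateD[OF rational_conjugate_sym[OF that m(2) m0]] by blast
  have "rsquarefree M"
    unfolding rsquarefree_roots using simple roots by (simp add: evM derivM)
  then have "M = (\<Prod>y | rational_conjugate x y. [:- y, 1:])"
    using complex_poly_decompose_rsquarefree[of M] leadM by (simp add: evM roots)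
  moreover have "is_min_poly_rat M x"
    unfolding is_min_poly_rat_def
  proof (intro conjI allI impI)
    show "coeff M i \<in> \<rat>" for i by (simp add: M_def coeff_map_poly)
    show "lead_coeff M = 1" by (rule leadM)
    show "poly M x = 0" using m(2) by (simp add: evM)
  next
    fix g assume g: "(\<forall>i. coeff g i \<in> \<rat>) \<and> g \<noteq> 0 \<and> poly g x = 0"
    then obtain h where h: "map_poly of_rat h = g" using rational_coeffs_imp_map_poly_of_rat by blast
    then have "m dvd h" using g m(3) by (simp add: rat_eval_def)
    moreover have "h \<noteq> 0" using h g by auto
    ultimately have "degree m \<le> degree h" by (rule dvd_imp_degree_le)
    moreover have "degree h = degree g" using h by (metis degree_map_poly of_rat_eq_0_iff)
    ultimately show "degree M \<le> degree g" using degM by simp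
  qed
  ultimately show ?thesis by simp
qed

lemma scale_poly_prod:
  assumes "a \<noteq> 0"
  shows "scale_poly a (\<Prod>i\<in>A. [:- g i, 1:]) = (\<Prod>i\<in>A. [:- (a * g i), 1:])"
proof -
  have deg: "degree (\<Prod>i\<in>A. [:- g i, 1:]) = card A"
    by (induction A rule: infinite_finite_induct)
       (simp_all add: degree_mult_eq prod_zero_iff del: mult_pCons_left)
  have factor: "smult a (pcompose [:- g i, 1:] [:0, 1 / a:]) = [:- (a * g i), 1:]" for i
    using assms by (simp add: pcompose_pCons)
  have "scale_poly a (\<Prod>i\<in>A. [:- g i, 1:])
      = smult (\<Prod>i\<in>A. a) (\<Prod>i\<in>A. pcompose [:- g i, 1:] [:0, 1 / a:])"
    by (simp only: scale_poly_def deg pcompose_prod prod_constant)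
  also have "\<dots> = (\<Prod>i\<in>A. smult a (pcompose [:- g i, 1:] [:0, 1 / a:]))"
    by (simp only: prod_smult)
  also have "\<dots> = (\<Prod>i\<in>A. [:- (a * g i), 1:])" by (simp only: factor)
  finally show ?thesis .
qed

lemma is_min_poly_rat_scale_poly_prod:
  assumes "a \<noteq> 0" and "finite A" and inj: "inj_on g A"
    and conj: "{y. rational_conjugate x y} = (\<lambda>i. a * g i) ` A"
  shows "is_min_poly_rat (scale_poly a (\<Prod>i\<in>A. [:- g i, 1:])) x"
proof -
  have "finite {y. rational_conjugate x y}" unfolding conj using assms(2) by simp
  then have "is_min_poly_rat (\<Prod>y | rational_conjugate x y. [:- y, 1:]) x"
    by (rule is_min_poly_rat_prod_conjugates)
  moreover have "inj_on (\<lambda>i. a * g i) A" using assms(1) inj by (auto simp: inj_on_def)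
  ultimately show ?thesis
    unfolding scale_poly_prod[OF assms(1)] conj by (simp add: prod.reindex)
qed

section \<open>Powers of roots of unity as rational conjugates\<close>

definition int_eval :: "int poly \<Rightarrow> complex \<Rightarrow> complex" where
  "int_eval h x = poly (map_poly of_int h) x"

lemma int_eval_simps [simp]:
  "int_eval 0 x = 0"
  "int_eval 1 x = 1"
  "int_eval (pCons c h) x = of_int c + x * int_eval h x"
  "int_eval (g + h) x = int_eval g x + int_eval h x"
  "int_eval (g * h) x = int_eval g x * int_eval h x"
  by (simp_all add: int_eval_def map_poly_pCons poly_map_poly_add poly_map_poly_mult)

lemma int_eval_diff [simp]: "int_eval (g - h) x = int_eval g x - int_eval h x"
  using int_eval_simps(4)[of "g - h" h x] by (simp del: int_eval_simps(4))

lemma int_eval_smult [simp]: "int_eval (smult c h) x = of_int c * int_eval h x"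
  using int_eval_simps(5)[of "[:c:]" h x] by simp

lemma int_eval_power [simp]: "int_eval (h ^ n) x = int_eval h x ^ n"
  by (induction n) simp_all

lemma int_eval_monom [simp]: "int_eval (monom c n) x = of_int c * x ^ n"
  by (induction n) (simp_all add: monom_0 monom_Suc)

lemma int_eval_pcompose [simp]: "int_eval (pcompose g h) x = int_eval g (int_eval h x)"
  by (induction g) (simp_all add: pcompose_pCons)

text \<open>
  Rational relations between roots of unity can thus be studied with integer polynomials, which can
  be reduced modulo a prime.
\<close>

lemma clear_denominators:
  "\<exists>c g. c \<noteq> 0 \<and> (\<forall>x. of_int c * rat_eval h x = int_eval g x)"
proof (induction h)
  case 0
  show ?case by (rule exI[of _ 1], rule exI[of _ 0]) simp
next
  case (pCons a h)
  then obtain c g where cg: "c \<noteq> 0" "\<And>x. of_int c * rat_eval h x = int_eval g x" by blast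
  obtain n d where nd: "a = of_int n / of_int d" "d > 0"
    by (metis quotient_of_div quotient_of_denom_pos surj_pair)
  have a: "(of_rat a :: complex) = of_int n / of_int d" using nd(1) by (simp add: of_rat_divide)
  have "of_int (c * d) * rat_eval (pCons a h) x = int_eval (pCons (n * c) (smult d g)) x" for x
    using nd(2) cg(2)[of x, symmetric] by (simp add: a field_simps)
  then show ?case using cg(1) nd(2) by (metis mult_eq_0_iff less_irrefl)
qed

lemma of_nat_dvd_of_nat: "m dvd n \<Longrightarrow> (of_nat m :: 'a::comm_semiring_1) dvd of_nat n"
  by (auto simp: dvd_def)

lemma prime_dvd_power_add_diff:
  fixes a b :: "'a::comm_ring_1"
  assumes "prime p"
  shows "of_nat p dvd (a + b) ^ p - a ^ p - b ^ p"
proof -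
  have p0: "p > 0" using assms by (rule prime_gt_0_nat)
  have "{..p} = insert 0 (insert p {0<..<p})" using p0 by auto
  then have "(a + b) ^ p = a ^ p + b ^ p + (\<Sum>k\<in>{0<..<p}. of_nat (p choose k) * a ^ k * b ^ (p - k))"
    using p0 by (simp add: binomial_ring)
  moreover have "of_nat p dvd (\<Sum>k\<in>{0<..<p}. of_nat (p choose k) * a ^ k * b ^ (p - k))"
    using assms by (intro dvd_sum dvd_mult2) (auto intro!: of_nat_dvd_of_nat dvd_choose_prime)
  ultimately show ?thesis by (simp add: algebra_simps)
qed

lemma prime_dvd_power_diff_int:
  assumes "prime p"
  shows "int p dvd c ^ p - c"
proof -
  define n where "n = nat (c mod int p)"
  have cn: "[c = int n] (mod int p)"
  proof -
    have "0 \<le> c mod int p" using prime_gt_0_nat[OF assms] by (intro pos_mod_sign) simp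
    then show ?thesis by (simp add: n_def)
  qed
  have "[n ^ p = n] (mod p)"
  proof (cases "p dvd n")
    case True
    then have "p dvd n ^ p" using prime_gt_0_nat[OF assms] by (metis dvd_power dvd_trans)
    then show ?thesis using True by (simp only: cong_def dvd_imp_mod_0)
  next
    case False
    have "[n * n ^ (p - 1) = n * 1] (mod p)"
      by (intro cong_mult cong_refl fermat_theorem assms False)
    then show ?thesis using assms by (simp add: power_eq_if prime_gt_0_nat)
  qed
  then have "[int n ^ p = int n] (mod int p)" by (metis cong_int_iff of_nat_power)
  then have "[c ^ p = c] (mod int p)" by (meson cn cong_pow cong_sym cong_trans)
  then show ?thesis by (simp add: cong_iff_dvd_diff)
qed

lemma int_eval_of_nat [simp]: "int_eval (of_nat n) x = of_nat n"
  by (induction n) simp_all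

text \<open>
  The congruence \<open>h(X\<^sup>p) \<equiv> h(X)\<^sup>p\<close> modulo \<open>p\<close>, stated for values because only those are needed.
\<close>

lemma int_eval_power_prime:
  assumes "prime p"
  shows "\<exists>r. \<forall>x. int_eval h (x ^ p) = int_eval h x ^ p + of_nat p * int_eval r x"
proof (induction h)
  case 0
  show ?case using assms by (intro exI[of _ 0]) (simp add: prime_gt_0_nat)
next
  case (pCons c h)
  then obtain r where r: "\<And>x. int_eval h (x ^ p) = int_eval h x ^ p + of_nat p * int_eval r x"
    by blast
  obtain e where e: "([:c:] + pCons 0 h) ^ p - [:c:] ^ p - pCons 0 h ^ p = of_nat p * e"
    using prime_dvd_power_add_diff[OF assms] by (blast elim: dvdE)
  obtain d where d: "c ^ p - c = int p * d"
    using prime_dvd_power_diff_int[OF assms] by (blast elim: dvdE)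
  have "int_eval (pCons c h) (x ^ p) = int_eval (pCons c h) x ^ p
      + of_nat p * int_eval (monom 1 p * r - e - [:d:]) x" for x
  proof -
    have "int_eval (([:c:] + pCons 0 h) ^ p - [:c:] ^ p - pCons 0 h ^ p) x
        = int_eval (of_nat p * e) x" by (simp only: e)
    then have 1: "int_eval (pCons c h) x ^ p
        = of_int c ^ p + (x * int_eval h x) ^ p + of_nat p * int_eval e x"
      by (simp add: diff_eq_eq algebra_simps)
    have "(of_int (c ^ p - c) :: complex) = of_int (int p * d)" by (simp only: d)
    then have 2: "(of_int c :: complex) ^ p = of_int c + of_nat p * of_int d"
      by (simp add: algebra_simps)
    show ?thesis
      unfolding 1 2 by (simp add: r power_mult_distrib algebra_simps)
  qed
  then show ?case by blast
qed

text \<open>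
  A form of Gauss's lemma.  Let \<open>g\<close> be the primitive part of an integer polynomial of least degree
  with root \<open>x\<close>.  Pseudo-division shows that \<open>g\<close> divides \<open>a h\<close> for some nonzero integer \<open>a\<close> whenever
  \<open>h\<close> vanishes at \<open>x\<close>; comparing contents, \<open>a\<close> divides the cofactor and cancels.  As \<open>g\<close> divides the
  monic polynomial \<open>X\<^sup>n - 1\<close>, its leading coefficient is a unit.
\<close>

lemma exists_minimal_integer_poly:
  assumes "x ^ n = 1" and "n > 0"
  obtains g where "is_unit (lead_coeff g)" and "int_eval g x = 0" and "degree g > 0"
    and "\<And>h. int_eval h x = 0 \<Longrightarrow> g dvd h"
proof -
  define P where "P = (\<lambda>g. g \<noteq> 0 \<and> int_eval g x = 0)"
  define f where "f = arg_min degree P"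
  have xn: "int_eval (monom 1 n - 1) x = 0" using assms by simp
  have "coeff (monom (1::int) n - 1) n = 1" using assms by simp
  then have "monom (1::int) n - 1 \<noteq> 0" by (metis coeff_0 zero_neq_one)
  then have "P (monom 1 n - 1)" using xn by (simp add: P_def)
  then have Pf: "P f" and least: "\<And>h. P h \<Longrightarrow> degree f \<le> degree h"
    unfolding f_def by (auto intro: arg_min_natI arg_min_nat_le)
  define g where "g = primitive_part f"
  have g0: "g \<noteq> 0" and cont: "content g = 1" and deg: "degree g = degree f"
    using Pf by (auto simp: g_def P_def)
  have "int_eval (smult (content f) g) x = 0" using Pf by (simp add: g_def P_def)
  then have gx: "int_eval g x = 0" using Pf by (simp add: P_def)
  have dvd: "g dvd h" if hx: "int_eval h x = 0" for h
  proof -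
    define r where "r = pseudo_mod h g"
    obtain a q where a: "a \<noteq> 0" and aq: "smult a h = g * q + r"
      using pseudo_mod(1)[OF g0] unfolding r_def by blast
    have "int_eval (smult a h) x = 0" using hx by simp
    then have "int_eval r x = 0" unfolding aq using gx by simp
    moreover have "r = 0 \<or> degree r < degree g"
      unfolding r_def by (rule pseudo_mod(2)[OF g0])
    ultimately have "r = 0" using least[of r] deg by (simp add: P_def) linarith
    then have gq: "smult a h = g * q" using aq by simp
    then have "content (smult a h) = content q" by (simp add: content_mult cont)
    then have "a dvd content q" 
      by (metis content_smult dvd_triv_left normalize_dvd_iff)
    then have "[:a:] dvd q" by (simp add: const_poly_dvd_iff_dvd_content)
    then obtain q' where "q = [:a:] * q'" by (blast elim: dvdE)
    then have "smult a h = smult a (g * q')" using gq by simp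
    then have "[:a:] * h = [:a:] * (g * q')" by simp
    then have "h = g * q'" using a by (subst (asm) mult_left_cancel) auto
    then show ?thesis by simp
  qed
  obtain k where k: "monom 1 n - 1 = g * k" using dvd[OF xn] by (blast elim: dvdE)
  have "degree (monom (1::int) n - 1) = n"
    using assms(2) degree_add_eq_left[of "-1" "monom (1::int) n"] by (simp add: degree_monom_eq)
  then have "lead_coeff (monom (1::int) n - 1) = 1" using assms(2) by simp
  then have "lead_coeff g * lead_coeff k = 1" unfolding k by (simp add: lead_coeff_mult)
  then have unit: "is_unit (lead_coeff g)" by (metis dvd_triv_left)
  have "degree g \<noteq> 0"
  proof
    assume "degree g = 0"
    then obtain c where "g = [:c:]" by (rule degree_eq_zeroE)
    with gx g0 show False by simp
  qed
  with that unit gx dvd show thesis by blast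
qed

text \<open>
  The heart of the irreducibility of cyclotomic polynomials.  Suppose that \<open>g(x\<^sup>p) \<noteq> 0\<close> and let
  \<open>X\<^sup>n - 1 = g k\<close>.  Then \<open>k(x\<^sup>p) = 0\<close>, and the derivative at \<open>x\<^sup>p\<close> gives
  \<open>n x\<^sup>p\<^sup>(\<^sup>n\<^sup>-\<^sup>1\<^sup>) = g(x\<^sup>p) k'(x\<^sup>p)\<close>.  Here \<open>g(x\<^sup>p)\<close> is \<open>p\<close> times an element of \<open>\<int>[x]\<close>, so \<open>n = p s(x)\<close>
  for an integer polynomial \<open>s\<close>, which may be reduced modulo \<open>g\<close> to a remainder of degree less than
  \<open>degree g\<close>.  As no nonzero integer polynomial of so small a degree vanishes at \<open>x\<close>, the equation
  \<open>n = p s(x)\<close> is an equation of polynomials, and \<open>p\<close> divides \<open>n\<close>.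
\<close>

lemma rational_conjugate_power_prime:
  assumes xn: "x ^ n = 1" and n: "n > 0" and p: "prime p" and pn: "\<not> p dvd n"
  shows "rational_conjugate x (x ^ p)"
proof -
  obtain g where g: "is_unit (lead_coeff g)" "int_eval g x = 0" "degree g > 0"
      "\<And>h. int_eval h x = 0 \<Longrightarrow> g dvd h"
    using exists_minimal_integer_poly[OF xn n] by blast
  have root: "int_eval g (x ^ p) = 0"
  proof (rule ccontr)
    assume nz: "int_eval g (x ^ p) \<noteq> 0"
    have "int_eval (monom 1 n - 1) x = 0" using xn by simp
    then obtain k where k: "monom 1 n - 1 = g * k" using g(4) by (blast elim: dvdE)
    obtain r where "int_eval g (x ^ p) = int_eval g x ^ p + of_nat p * int_eval r x"
      using int_eval_power_prime[OF p] by blast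
    then have gr: "int_eval g (x ^ p) = of_nat p * int_eval r x"
      using g(2) p by (simp add: prime_gt_0_nat)
    have xpn: "(x ^ p) ^ n = 1" using xn by (metis mult.commute power_mult power_one)
    have "int_eval (monom 1 n - 1) (x ^ p) = 0" using xpn by simp
    then have kx: "int_eval k (x ^ p) = 0" unfolding k using nz by simp
    have "pderiv (monom 1 n - 1) = pderiv g * k + g * pderiv k"
      unfolding k by (simp add: pderiv_mult algebra_simps)
    then have "int_eval (monom (int n) (n - 1)) (x ^ p)
        = int_eval (pderiv g * k + g * pderiv k) (x ^ p)"
      by (simp add: pderiv_diff pderiv_monom)
    then have "of_nat n * (x ^ p) ^ (n - 1) = int_eval g (x ^ p) * int_eval (pderiv k) (x ^ p)"
      using kx by simp
    then have "of_nat n * (x ^ p) ^ (n - 1) * x ^ p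
        = of_nat p * int_eval (r * pcompose (pderiv k) (monom 1 p) * monom 1 p) x"
      by (simp add: gr)
    then have ns: "of_nat n = of_nat p * int_eval (r * pcompose (pderiv k) (monom 1 p) * monom 1 p) x"
      (is "_ = _ * int_eval ?s x")
      using xpn n by (simp add: mult.assoc flip: power_Suc2)
    have g0: "g \<noteq> 0" using g(3) by auto
    \<comment> \<open>Pseudo-division by \<open>g\<close> multiplies the dividend by \<open>e\<close>, which is a unit here.\<close>
    define e where "e = lead_coeff g ^ (Suc (degree ?s) - degree g)"
    obtain q u where qu: "pseudo_divmod ?s g = (q, u)" by fastforce
    have eu: "is_unit e" unfolding e_def is_unit_power_iff using g(1) by blast
    have "smult e ?s = g * q + u" and du: "u = 0 \<or> degree u < degree g"
      using pseudo_divmod[OF g0 qu] by (simp_all add: e_def)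
    then have "int_eval (smult e ?s) x = int_eval u x" using g(2) by (simp only: int_eval_simps) simp
    then have "int_eval (smult (int p) u - [:e * int n:]) x = 0"
      using ns by (simp add: algebra_simps)
    then have gd: "g dvd smult (int p) u - [:e * int n:]" by (rule g(4))
    have "degree (smult (int p) u - [:e * int n:]) < degree g"
      using du g(3) by (intro degree_diff_less) auto
    then have "smult (int p) u - [:e * int n:] = 0" 
      using dvd_imp_degree_le[OF gd] by linarith
    then have "coeff (smult (int p) u - [:e * int n:]) 0 = 0" by simp
    then have "int p * coeff u 0 = e * int n" by simp
    then have "int p dvd e * int n" by (metis dvd_triv_left)
    then have "int p dvd int n" using eu by (simp add: dvd_mult_unit_iff')
    then show False using pn by simp
  qed
  show ?thesis
    unfolding rational_conjugate_def
  proof (intro allI impI)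
    fix h assume hx: "rat_eval h x = 0"
    obtain c f where c: "c \<noteq> 0" and cf: "\<And>y. of_int c * rat_eval h y = int_eval f y"
      using clear_denominators by blast
    have "int_eval f x = 0" using cf[of x] hx by simp
    then obtain k where "f = g * k" using g(4) by (blast elim: dvdE)
    then have "int_eval f (x ^ p) = 0" using root by simp
    then show "rat_eval h (x ^ p) = 0" using cf[of "x ^ p"] c by simp
  qed
qed

lemma rational_conjugate_power_coprime:
  assumes "n > 0" and "x ^ n = 1" and "coprime a n"
  shows "rational_conjugate x (x ^ a)"
  using assms(3)
proof (induction a rule: less_induct)
  case (less a)
  consider "a = 0" | "a = 1" | "a > 1" by linarith
  then show ?case
  proof cases
    assume "a = 0"
    then have "n = 1" using less.prems by simp
    then show ?thesis using assms \<open>a = 0\<close> by simp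
  next
    assume a: "a > 1"
    then obtain p where p: "prime p" "p dvd a" using prime_factor_nat by (metis less_irrefl)
    then obtain b where b: "a = p * b" by (blast elim: dvdE)
    have "b < a" using a b prime_gt_1_nat[OF p(1)] by (cases "b = 0") auto
    moreover have cop: "coprime b n" "coprime p n" using less.prems b by simp_all
    ultimately have "rational_conjugate x (x ^ b)" using less.IH by blast
    moreover have "rational_conjugate (x ^ b) ((x ^ b) ^ p)"
    proof (rule rational_conjugate_power_prime)
      show "(x ^ b) ^ n = 1" using assms(2) by (metis mult.commute power_mult power_one)
      show "\<not> p dvd n" using cop(2) p(1) by (metis coprime_absorb_left not_prime_unit)
    qed (use assms p in auto)
    ultimately show ?thesis
      unfolding b by (metis mult.commute power_mult rational_conjugate_trans)
  qed simp
qed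

section \<open>Primitive roots of unity\<close>

lemma primitive_root_unity_iff:
  "primitive_root_unity n w \<longleftrightarrow> n > 0 \<and> (\<forall>k. w ^ k = 1 \<longleftrightarrow> n dvd k)"
proof
  assume w: "primitive_root_unity n w"
  then have n: "n > 0" and wn: "w ^ n = 1" and least: "\<And>k. 0 < k \<Longrightarrow> k < n \<Longrightarrow> w ^ k \<noteq> 1"
    unfolding primitive_root_unity_def by blast+
  have "w ^ k = 1 \<longleftrightarrow> w ^ (k mod n) = 1" for k
  proof -
    have "w ^ k = w ^ (n * (k div n) + k mod n)" by simp
    also have "\<dots> = w ^ (k mod n)" by (simp only: power_add power_mult wn power_one mult_1)
    finally show ?thesis by (rule arg_cong)
  qed
  moreover have "w ^ (k mod n) = 1 \<longleftrightarrow> k mod n = 0" for k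
    using least[of "k mod n"] n by (cases "k mod n = 0") auto
  ultimately have "w ^ k = 1 \<longleftrightarrow> n dvd k" for k by (metis mod_eq_0_iff_dvd)
  with n show "n > 0 \<and> (\<forall>k. w ^ k = 1 \<longleftrightarrow> n dvd k)" by blast
next
  assume "n > 0 \<and> (\<forall>k. w ^ k = 1 \<longleftrightarrow> n dvd k)"
  then have n: "n > 0" and w: "\<And>k. (w ^ k = 1) = (n dvd k)" by (rule conjunct1, metis)
  show "primitive_root_unity n w"
    unfolding primitive_root_unity_def w using n nat_dvd_not_less by simp
qed

lemma primitive_root_unity_gt_0: "primitive_root_unity n w \<Longrightarrow> n > 0"
  and primitive_root_unity_eq_1_iff: "primitive_root_unity n w \<Longrightarrow> w ^ k = 1 \<longleftrightarrow> n dvd k"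
  unfolding primitive_root_unity_iff by blast+

lemma primitive_root_unityI:
  "n > 0 \<Longrightarrow> (\<And>k. w ^ k = 1 \<longleftrightarrow> n dvd k) \<Longrightarrow> primitive_root_unity n w"
  unfolding primitive_root_unity_iff by blast

lemma primitive_root_unity_power_self: "primitive_root_unity n w \<Longrightarrow> w ^ n = 1"
  by (simp add: primitive_root_unity_def)

lemma power_root_unity_cong:
  fixes w :: complex
  assumes w: "w ^ n = 1" and ab: "[a = b] (mod n)"
  shows "w ^ a = w ^ b"
proof -
  have "w ^ k = w ^ (k mod n)" for k
  proof -
    have "w ^ k = w ^ (n * (k div n) + k mod n)" by simp
    also have "\<dots> = w ^ (k mod n)" by (simp only: power_add power_mult w power_one mult_1)
    finally show ?thesis .
  qed
  then show ?thesis using ab unfolding cong_def by metis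
qed

lemma primitive_root_unity_power:
  assumes "primitive_root_unity (d * n) w" and "gcd k (d * n) = d"
  shows "primitive_root_unity n (w ^ k)"
proof -
  have dn: "d > 0" "n > 0" using primitive_root_unity_gt_0[OF assms(1)] by simp_all
  note w = primitive_root_unity_eq_1_iff[OF assms(1)]
  obtain l where l: "k = d * l" using assms(2) by (metis dvdE gcd_dvd1)
  have "d * gcd l n = d * 1" using assms(2) unfolding l by (simp add: gcd_mult_distrib_nat)
  then have "gcd l n = 1" using dn by simp
  then have "coprime n l" by (simp only: coprime_iff_gcd_eq_1 gcd.commute)
  then have "n dvd l * j \<longleftrightarrow> n dvd j" for j by (rule coprime_dvd_mult_right_iff)
  then show ?thesis
    using dn by (intro primitive_root_unityI) (simp_all add: l w mult.assoc flip: power_mult)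
qed

lemma primitive_root_unity_mult:
  assumes "coprime m n" and "primitive_root_unity m u" and "primitive_root_unity n v"
  shows "primitive_root_unity (m * n) (u * v)"
proof -
  note u = primitive_root_unity_eq_1_iff[OF assms(2)] and v = primitive_root_unity_eq_1_iff[OF assms(3)]
  have "m * n dvd k" if k: "(u * v) ^ k = 1" for k
  proof -
    have "u ^ (n * k) = (u * v) ^ (n * k)" "v ^ (m * k) = (u * v) ^ (m * k)"
      by (simp_all add: power_mult_distrib u v)
    then have "u ^ (n * k) = 1" "v ^ (m * k) = 1"
      using k by (metis mult.commute power_mult power_one)+
    then have "m dvd k" "n dvd k"
      using assms(1) by (simp_all add: u v coprime_dvd_mult_right_iff coprime_commute)
    then show ?thesis using assms(1) by (simp add: divides_mult)
  qed
  moreover have "(u * v) ^ k = 1" if "m * n dvd k" for k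
    using that by (metis dvd_mult_left dvd_mult_right mult_1 power_mult_distrib u v)
  ultimately show ?thesis
    using primitive_root_unity_gt_0[OF assms(2)] primitive_root_unity_gt_0[OF assms(3)]
    by (intro primitive_root_unityI) auto
qed

text \<open>
  The order of \<open>w\<close> doubles that of \<open>w\<^sup>2\<close> because the latter is even.
\<close>

lemma primitive_root_unity_sqrt:
  assumes "primitive_root_unity (2 * n) (w\<^sup>2)"
  shows "primitive_root_unity (4 * n) w"
proof -
  have n: "n > 0" using primitive_root_unity_gt_0[OF assms] by simp
  have w: "w ^ (2 * k) = 1 \<longleftrightarrow> 2 * n dvd k" for k
    using primitive_root_unity_eq_1_iff[OF assms] by (simp only: power_mult)
  have "4 * n dvd k" if k: "w ^ k = 1" for k
  proof -
    have "w ^ (2 * k) = 1" using k by (metis mult.commute power_mult power_one)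
    then obtain j where j: "k = 2 * n * j" using w by (blast elim: dvdE)
    then have "w ^ (2 * (n * j)) = 1" using k by (simp add: mult.assoc)
    then have "2 * n dvd n * j" using w by blast
    then show ?thesis using n j by (auto simp: dvd_def mult_ac)
  qed
  moreover have "w ^ k = 1" if "4 * n dvd k" for k
  proof -
    obtain j where "k = 2 * (2 * n * j)" using \<open>4 * n dvd k\<close> by (auto simp: dvd_def mult_ac)
    then show ?thesis using w[of "2 * n * j"] by simp
  qed
  ultimately show ?thesis using n by (intro primitive_root_unityI) auto
qed

text \<open>
  The powers of \<open>w\<close> are \<open>n\<close> distinct \<open>n\<close>-th roots of unity, hence all of them.
\<close>

lemma primitive_root_unity_totatives:
  assumes w: "primitive_root_unity n w"
  shows "bij_betw (\<lambda>a. w ^ a) (totatives n) {z. primitive_root_unity n z}"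
proof -
  note n = primitive_root_unity_gt_0[OF w] and wk = primitive_root_unity_eq_1_iff[OF w]
  have w0: "w \<noteq> 0" using wk[of n] n by (auto simp: power_0_left)
  have le: "w ^ a = w ^ b \<longleftrightarrow> n dvd b - a" if "a \<le> b" for a b
  proof -
    have "w ^ b = w ^ a * w ^ (b - a)" using that by (simp flip: power_add)
    then show ?thesis using w0 wk[of "b - a"] by auto
  qed
  have inj: "inj_on (\<lambda>a. w ^ a) {0<..n}"
  proof (rule linorder_inj_onI')
    fix a b assume "a \<in> {0<..n}" "b \<in> {0<..n}" "a < b"
    then show "w ^ a \<noteq> w ^ b" using le[of a b] by (auto dest: dvd_imp_le)
  qed
  have "(\<lambda>a. w ^ a) ` {0<..n} = {z. z ^ n = 1}"
  proof (rule card_subset_eq)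
    show "finite {z::complex. z ^ n = 1}" using n by (simp add: finite_roots_unity)
    show "(\<lambda>a. w ^ a) ` {0<..n} \<subseteq> {z. z ^ n = 1}"
      using wk by (auto simp flip: power_mult)
    show "card ((\<lambda>a. w ^ a) ` {0<..n}) = card {z::complex. z ^ n = 1}"
      using n by (simp add: card_image[OF inj] card_roots_unity_eq)
  qed
  then have roots: "\<exists>a\<in>{0<..n}. z = w ^ a" if "z ^ n = 1" for z using that by auto
  have prim: "primitive_root_unity n (w ^ a) \<longleftrightarrow> coprime a n" for a
  proof
    assume "coprime a n"
    then show "primitive_root_unity n (w ^ a)"
      using primitive_root_unity_power[of 1 n w a] w by simp
  next
    assume p: "primitive_root_unity n (w ^ a)"
    define d where "d = gcd a n"
    obtain b m where b: "a = d * b" "n = d * m" by (metis d_def dvdE gcd_dvd1 gcd_dvd2)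
    have "n dvd a * m" using b by simp
    then have "(w ^ a) ^ m = 1" using wk by (simp flip: power_mult)
    then have "n dvd m" using primitive_root_unity_eq_1_iff[OF p] by simp
    then have "d * m dvd 1 * m" using b by simp
    moreover have "m > 0" using n b(2) by (cases m) auto
    ultimately have "d = 1" by (metis dvd_mult_cancel2 mult.commute nat_dvd_1_iff_1 nat_mult_dvd_cancel_disj not_gr0)
    then show "coprime a n" by (simp only: d_def coprime_iff_gcd_eq_1)
  qed
  show ?thesis
    unfolding bij_betw_def
  proof
    show "inj_on (\<lambda>a. w ^ a) (totatives n)"
      by (rule inj_on_subset[OF inj totatives_subset])
    show "(\<lambda>a. w ^ a) ` totatives n = {z. primitive_root_unity n z}"
    proof safe
      fix a assume "a \<in> totatives n"
      then show "primitive_root_unity n (w ^ a)" by (simp add: prim in_totatives_iff)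
    next
      fix z assume z: "primitive_root_unity n z"
      then have "z ^ n = 1" by (simp add: primitive_root_unity_def)
      then obtain a where "a \<in> {0<..n}" "z = w ^ a" using roots by blast
      then show "z \<in> (\<lambda>a. w ^ a) ` totatives n"
        using z by (auto simp: prim in_totatives_iff)
    qed
  qed
qed

lemma primitive_root_unity_half:
  assumes "primitive_root_unity (2 * n) w"
  shows "w ^ n = - 1"
proof -
  have "n > 0" using primitive_root_unity_gt_0[OF assms] by simp
  then have "w ^ n \<noteq> 1" using assms by (simp add: primitive_root_unity_def)
  moreover have "(w ^ n)\<^sup>2 = 1"
    using primitive_root_unity_power_self[OF assms] by (simp add: mult.commute flip: power_mult)
  ultimately show ?thesis by (auto simp: power2_eq_1_iff)
qed

lemma primitive_root_unity_uminus:
  assumes "primitive_root_unity (4 * n) w"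
  shows "primitive_root_unity (4 * n) (- w)"
proof (rule primitive_root_unity_sqrt)
  show "primitive_root_unity (2 * n) ((- w)\<^sup>2)"
    using primitive_root_unity_power[of 2 "2 * n" w 2] assms by simp
qed

text \<open>
  The exponents \<open>i\<close> and \<open>j\<close> project the group of \<open>mn\<close>-th roots of unity onto its factors of orders \<open>m\<close>
  and \<open>n\<close>.
\<close>

lemma coprime_exponents:
  fixes m n :: nat
  assumes "coprime m n"
  obtains i j where "[i = 1] (mod m)" "[i = 0] (mod n)" "[j = 0] (mod m)" "[j = 1] (mod n)"
  using binary_chinese_remainder_nat[OF assms] by metis

lemma primitive_root_unity_mult_recover_factor:
  assumes "primitive_root_unity m x" and "primitive_root_unity n y"
    and "[i = 1] (mod m)" "[i = 0] (mod n)"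
  shows "(x * y) ^ i = x"
proof -
  have "x ^ i = x ^ 1" "y ^ i = y ^ 0"
    using assms power_root_unity_cong primitive_root_unity_power_self by blast+
  then show ?thesis by (simp only: power_mult_distrib power_0 power_one_right mult_1_right)
qed

lemma primitive_root_unity_split:
  assumes cop: "coprime m n" and w: "primitive_root_unity (m * n) w"
  obtains x y where "primitive_root_unity m x" "primitive_root_unity n y" "w = x * y"
proof -
  obtain i j where ij: "[i = 1] (mod m)" "[i = 0] (mod n)" "[j = 0] (mod m)" "[j = 1] (mod n)"
    by (rule coprime_exponents[OF cop])
  have mn: "m > 0" "n > 0" using primitive_root_unity_gt_0[OF w] by simp_all
  have factor: "primitive_root_unity a (w ^ k)"
    if ab: "coprime a b" "a * b = m * n" and k: "[k = 1] (mod a)" "[k = 0] (mod b)" for a b k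
  proof (rule primitive_root_unityI)
    show "a > 0" using mn ab(2) by (cases a) auto
    have bk: "b dvd k" using k(2) by (simp add: cong_0_iff)
    have "coprime a k" using cong_imp_coprime[OF cong_sym[OF k(1)]] by (simp add: coprime_commute)
    moreover have "a * b dvd k * l \<longleftrightarrow> a dvd k * l \<and> b dvd k * l" for l
      using ab(1) by (metis divides_mult dvd_mult_left dvd_mult_right)
    ultimately have "a * b dvd k * l \<longleftrightarrow> a dvd l" for l
      using bk by (simp add: coprime_dvd_mult_right_iff)
    then show "(w ^ k) ^ l = 1 \<longleftrightarrow> a dvd l" for l
      by (simp only: power_mult[symmetric] primitive_root_unity_eq_1_iff[OF w] ab(2)[symmetric])
  qed
  have "[i + j = 1 + 0] (mod m)" "[i + j = 0 + 1] (mod n)" by (intro cong_add ij)+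
  then have "[i + j = 1] (mod m * n)" using cop by (simp add: coprime_cong_mult_nat)
  then have "w ^ (i + j) = w ^ 1"
    by (rule power_root_unity_cong[OF primitive_root_unity_power_self[OF w]])
  then have "w = w ^ i * w ^ j" by (simp add: power_add)
  moreover have "primitive_root_unity m (w ^ i)" by (rule factor[OF cop refl ij(1,2)])
  moreover have "primitive_root_unity n (w ^ j)"
    by (rule factor[of n m]) (use cop ij in \<open>simp_all add: coprime_commute mult.commute\<close>)
  ultimately show thesis using that by blast
qed

lemma primitive_root_unity_exists:
  assumes "n > 0"
  obtains w where "primitive_root_unity n w"
proof
  have inj: "inj_on (\<lambda>k. cis (2 * pi * real k / real n)) {..<n}"
    using bij_betw_roots_unity[OF assms] by (simp add: bij_betw_def)
  show "primitive_root_unity n (cis (2 * pi / real n))"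
    unfolding primitive_root_unity_def
  proof (intro conjI allI impI)
    show "cis (2 * pi / real n) ^ n = 1" using assms by (simp add: DeMoivre)
    fix k assume k: "0 < k \<and> k < n"
    then have "cis (2 * pi * real k / real n) \<noteq> cis (2 * pi * real 0 / real n)"
      using inj_onD[OF inj, of k 0] by auto
    then show "cis (2 * pi / real n) ^ k \<noteq> 1" by (simp add: DeMoivre mult_ac)
  qed (rule assms)
qed

lemma rational_conjugate_primitive_roots:
  assumes "primitive_root_unity n w" and "primitive_root_unity n z"
  shows "rational_conjugate w z"
proof -
  obtain a where "a \<in> totatives n" "z = w ^ a"
    using primitive_root_unity_totatives[OF assms(1)] assms(2) by (auto simp: bij_betw_def)
  then show ?thesis
    using rational_conjugate_power_coprime[of n w a] primitive_root_unity_gt_0[OF assms(1)]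
      primitive_root_unity_eq_1_iff[OF assms(1), of n]
    by (simp add: in_totatives_iff)
qed

section \<open>Polynomial functions of conjugates\<close>

text \<open>
  Automorphisms of cyclotomic fields are replaced by the fact that polynomial functions with rational
  coefficients map conjugates to conjugates.
\<close>

definition rational_poly_fun :: "(complex \<Rightarrow> complex) \<Rightarrow> bool" where
  "rational_poly_fun f \<longleftrightarrow> (\<exists>h. f = rat_eval h)"

named_theorems rational_poly_fun_intros

lemma rational_poly_funI: "(\<And>x. f x = rat_eval h x) \<Longrightarrow> rational_poly_fun f"
  unfolding rational_poly_fun_def by (rule exI[of _ h], rule ext)

lemma rational_poly_funE:
  assumes "rational_poly_fun f"
  obtains h where "\<And>x. f x = rat_eval h x"
  using assms unfolding rational_poly_fun_def by blast

lemma rational_poly_fun_const [rational_poly_fun_intros]: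
  assumes "c \<in> \<rat>"
  shows "rational_poly_fun (\<lambda>x. c)"
proof -
  obtain r where "c = of_rat r" using assms by (rule Rats_cases)
  then show ?thesis by (intro rational_poly_funI[of _ "[:r:]"]) simp
qed

lemma rational_poly_fun_id [rational_poly_fun_intros]: "rational_poly_fun (\<lambda>x. x)"
  by (rule rational_poly_funI[of _ "[:0, 1:]"]) simp

lemma rational_poly_fun_add [rational_poly_fun_intros]:
  assumes "rational_poly_fun f" and "rational_poly_fun g"
  shows "rational_poly_fun (\<lambda>x. f x + g x)"
proof -
  obtain h where h: "\<And>x. f x = rat_eval h x" using rational_poly_funE[OF assms(1)] by blast
  obtain k where k: "\<And>x. g x = rat_eval k x" using rational_poly_funE[OF assms(2)] by blast
  show ?thesis by (rule rational_poly_funI[of _ "h + k"]) (simp add: h k)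
qed

lemma rational_poly_fun_mult [rational_poly_fun_intros]:
  assumes "rational_poly_fun f" and "rational_poly_fun g"
  shows "rational_poly_fun (\<lambda>x. f x * g x)"
proof -
  obtain h where h: "\<And>x. f x = rat_eval h x" using rational_poly_funE[OF assms(1)] by blast
  obtain k where k: "\<And>x. g x = rat_eval k x" using rational_poly_funE[OF assms(2)] by blast
  show ?thesis by (rule rational_poly_funI[of _ "h * k"]) (simp add: h k)
qed

lemma rational_poly_fun_compose:
  assumes "rational_poly_fun f" and "rational_poly_fun g"
  shows "rational_poly_fun (\<lambda>x. f (g x))"
proof -
  obtain h where h: "\<And>x. f x = rat_eval h x" using rational_poly_funE[OF assms(1)] by blast
  obtain k where k: "\<And>x. g x = rat_eval k x" using rational_poly_funE[OF assms(2)] by blast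
  show ?thesis by (rule rational_poly_funI[of _ "pcompose h k"]) (simp add: h k)
qed

lemma rational_poly_fun_diff [rational_poly_fun_intros]:
  "rational_poly_fun f \<Longrightarrow> rational_poly_fun g \<Longrightarrow> rational_poly_fun (\<lambda>x. f x - g x)"
  using rational_poly_fun_add[of f "\<lambda>x. - 1 * g x"]
    rational_poly_fun_mult[OF rational_poly_fun_const[of "- 1"], of g]
  by simp

lemma rational_poly_fun_power [rational_poly_fun_intros]:
  "rational_poly_fun f \<Longrightarrow> rational_poly_fun (\<lambda>x. f x ^ n)"
  by (induction n) (simp_all add: rational_poly_fun_intros)

lemma rational_poly_fun_sum [rational_poly_fun_intros]:
  "(\<And>a. a \<in> A \<Longrightarrow> rational_poly_fun (f a)) \<Longrightarrow> rational_poly_fun (\<lambda>x. \<Sum>a\<in>A. f a x)"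
  by (induction A rule: infinite_finite_induct) (simp_all add: rational_poly_fun_intros)

lemma rational_conjugate_poly_fun:
  assumes "rational_conjugate x y" and "rational_poly_fun f"
  shows "rational_conjugate (f x) (f y)"
proof -
  obtain h where f: "\<And>x. f x = rat_eval h x" using rational_poly_funE[OF assms(2)] by blast
  have "rat_eval k (f y) = 0" if "rat_eval k (f x) = 0" for k
    using rational_conjugateD[OF assms(1), of "pcompose k h"] that by (simp add: f)
  then show ?thesis unfolding rational_conjugate_def by blast
qed

lemma rational_conjugate_satisfies_equation:
  assumes "rational_conjugate x y" and "rational_poly_fun f" and "rational_poly_fun g" and "f x = g x"
  shows "f y = g y"
proof -
  obtain h where h: "\<And>x. f x - g x = rat_eval h x"
    using rational_poly_funE[OF rational_poly_fun_diff[OF assms(2,3)]] by blast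
  have "rat_eval h x = 0" using h[of x] assms(4) by simp
  then have "rat_eval h y = 0" by (rule rational_conjugateD[OF assms(1)])
  then show ?thesis using h[of y] by simp
qed

lemma primitive_root_unity_conjugate:
  assumes w: "primitive_root_unity n w" and conj: "rational_conjugate w y"
  shows "primitive_root_unity n y"
proof -
  note n = primitive_root_unity_gt_0[OF w]
  have "w ^ n = 1" using primitive_root_unity_eq_1_iff[OF w] by simp
  \<comment> \<open>The polynomial \<open>X\<^sup>n - 1\<close> shows that \<open>w\<close> is algebraic, so that conjugacy is symmetric.\<close>
  then obtain m where m: "lead_coeff m = 1" "rat_eval m w = 0"
  proof -
    assume *: "\<And>m. lead_coeff m = 1 \<Longrightarrow> rat_eval m w = 0 \<Longrightarrow> thesis"
    have ev: "rat_eval (monom 1 k) w = w ^ k" for k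
      by (induction k) (simp_all add: monom_0 monom_Suc)
    show thesis
    proof (rule *[of "monom 1 n + [:- 1:]"])
      show "rat_eval (monom 1 n + [:- 1:]) w = 0"
        using \<open>w ^ n = 1\<close> by (simp only: rat_eval_simps ev) simp
      show "lead_coeff (monom 1 n + [:- 1 :: rat:]) = 1"
        using n degree_add_eq_left[of "[:- 1:]" "monom (1::rat) n"]
        by (simp add: degree_monom_eq coeff_pCons split: nat.split)
    qed
  qed
  then have "m \<noteq> 0" by auto
  then have conj': "rational_conjugate y w" using rational_conjugate_sym[OF conj m(2)] by blast
  have "y ^ k = 1 \<longleftrightarrow> w ^ k = 1" for k
  proof -
    have "rational_poly_fun (\<lambda>x. x ^ k)" "rational_poly_fun (\<lambda>x. 1)"
      by (intro rational_poly_fun_intros Rats_1)+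
    then show ?thesis using rational_conjugate_satisfies_equation[OF conj] rational_conjugate_satisfies_equation[OF conj'] by blast
  qed
  then show ?thesis
    using n by (intro primitive_root_unityI) (simp_all add: primitive_root_unity_eq_1_iff[OF w])
qed

text \<open>
  The hypotheses say that \<open>x\<close> and \<open>w\<close> generate the same field.  The equation \<open>f (g X) = X\<close> holds at \<open>x\<close>
  and hence at every conjugate \<open>y\<close> of \<open>x\<close>, so that \<open>y\<close> is the value of \<open>f\<close> at the primitive root \<open>g y\<close>.
\<close>

lemma rational_conjugates_cyclotomic_generator:
  assumes w: "primitive_root_unity n w"
    and f: "rational_poly_fun f" and g: "rational_poly_fun g"
    and "f w = x" and "g x = w"
  shows "{y. rational_conjugate x y} = f ` {z. primitive_root_unity n z}"
proof safe
  fix y assume xy: "rational_conjugate x y"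
  have "rational_conjugate w (g y)"
    using rational_conjugate_poly_fun[OF xy g] assms(5) by simp
  then have "primitive_root_unity n (g y)" by (rule primitive_root_unity_conjugate[OF w])
  moreover have "f (g y) = y"
    using rational_conjugate_satisfies_equation[OF xy rational_poly_fun_compose[OF f g] rational_poly_fun_id] assms(4,5)
    by simp
  ultimately show "y \<in> f ` {z. primitive_root_unity n z}" by (metis imageI mem_Collect_eq)
next
  fix z assume "primitive_root_unity n z"
  then have "rational_conjugate w z" by (rule rational_conjugate_primitive_roots[OF w])
  then show "rational_conjugate x (f z)"
    using rational_conjugate_poly_fun[OF _ f] assms(4) by metis
qed

section \<open>Quadratic Gauss sums\<close>

definition gauss_sum :: "nat \<Rightarrow> complex \<Rightarrow> complex" where
  "gauss_sum p x = (\<Sum>a\<in>{1..<p}. of_int (Legendre (int a) (int p)) * x ^ a)"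

context
  fixes p :: nat
  assumes p: "prime p" and p2: "p > 2"
begin

lemma Legendre_cong:
  assumes "[a = b] (mod int p)"
  shows "Legendre a p = Legendre b p"
proof -
  have "[x = a] (mod int p) \<longleftrightarrow> [x = b] (mod int p)" for x
    using assms cong_sym cong_trans by blast
  moreover have "[a = 0] (mod int p) \<longleftrightarrow> [b = 0] (mod int p)"
    using assms cong_sym cong_trans by blast
  ultimately show ?thesis by (simp only: Legendre_def QuadRes_def)
qed

lemma Legendre_values: "Legendre a p \<in> {-1, 0, 1}"
  by (simp add: Legendre_def)

lemma Legendre_square:
  assumes "\<not> int p dvd a"
  shows "Legendre a p * Legendre a p = 1"
  using assms by (simp add: Legendre_def cong_0_iff)

text \<open>
  A prime above 2 separates the possible values of the symbol, so Euler's criterion determines it.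
\<close>

lemma Legendre_eqI:
  assumes "[Legendre a p = m] (mod int p)" and "m \<in> {-1, 0, 1}"
  shows "Legendre a p = m"
proof (rule ccontr)
  assume ne: "Legendre a p \<noteq> m"
  have "int p dvd Legendre a p - m" using assms(1) by (simp add: cong_iff_dvd_diff)
  then have "int p \<le> \<bar>Legendre a p - m\<bar>" using ne by (intro zdvd_imp_le) auto
  also have "\<dots> \<le> 2" using Legendre_values[of a] assms(2) by auto
  finally show False using p2 by simp
qed

lemma Legendre_mult: "Legendre (a * b) p = Legendre a p * Legendre b p"
proof (rule Legendre_eqI)
  let ?e = "(p - 1) div 2"
  have "[Legendre (a * b) p = (a * b) ^ ?e] (mod int p)"
    using euler_criterion[OF p] p2 by simp
  also have "(a * b) ^ ?e = a ^ ?e * b ^ ?e" by (rule power_mult_distrib)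
  also have "[\<dots> = Legendre a p * Legendre b p] (mod int p)"
    using euler_criterion[OF p] p2 by (intro cong_mult cong_sym[of "Legendre _ _"]) simp_all
  finally show "[Legendre (a * b) p = Legendre a p * Legendre b p] (mod int p)" .
  show "Legendre a p * Legendre b p \<in> {-1, 0, 1}"
    using Legendre_values[of a] Legendre_values[of b] by auto
qed

lemma Legendre_minus_one: "Legendre (- 1) p = (- 1) ^ ((p - 1) div 2)"
  by (rule Legendre_eqI)
     (use euler_criterion[OF p p2, of "-1"] in simp, cases "even ((p - 1) div 2)", auto)

lemma bij_betw_residues_mult:
  assumes "coprime b p"
  shows "bij_betw (\<lambda>a. a * b mod p) {1..<p} {1..<p}"
proof -
  have "inj_on (\<lambda>a. a * b mod p) {1..<p}"
  proof (rule inj_onI)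
    fix x y assume xy: "x \<in> {1..<p}" "y \<in> {1..<p}" "x * b mod p = y * b mod p"
    then have "[x = y] (mod p)" using assms by (simp add: cong_def[symmetric] cong_mult_rcancel_nat)
    then show "x = y" using xy(1,2) by (simp add: cong_def)
  qed
  moreover have "(\<lambda>a. a * b mod p) ` {1..<p} \<subseteq> {1..<p}"
  proof safe
    fix a assume a: "a \<in> {1..<p}"
    then have "\<not> p dvd a" by (auto dest: dvd_imp_le)
    moreover have "\<not> p dvd b" using assms p by (metis coprime_absorb_right not_prime_unit)
    ultimately have "\<not> p dvd a * b" using p by (simp add: prime_dvd_mult_iff)
    then show "a * b mod p \<in> {1..<p}" using p2 by (auto simp: dvd_eq_mod_eq_0)
  qed
  ultimately show ?thesis by (simp add: bij_betw_def endo_inj_surj)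
qed

text \<open>
  Squaring modulo \<open>p\<close> is not injective on the nonzero residues, since \<open>1\<close> and \<open>p - 1\<close> have the same
  square; on a finite set it is therefore not surjective either.
\<close>

lemma exists_quadratic_nonresidue:
  obtains n where "coprime n p" and "Legendre (int n) p = - 1"
proof -
  have "\<not> inj_on (\<lambda>x. x * x mod p) {1..<p}"
  proof
    assume "inj_on (\<lambda>x. x * x mod p) {1..<p}"
    moreover have "(p - 1) * (p - 1) mod p = 1 * 1 mod p"
    proof -
      obtain k where "p = k + 2" using p2 by (metis add.commute le_Suc_ex less_imp_le)
      then have "(p - 1) * (p - 1) = 1 * 1 + p * k" by simp
      then show ?thesis by (simp only: mod_mult_self2)
    qed
    moreover have "p - 1 \<in> {1..<p}" "1 \<in> {1..<p}" using p2 by auto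
    ultimately have "p - 1 = 1" by (metis (no_types, lifting) inj_onD)
    then show False using p2 by simp
  qed
  then have "\<not> {1..<p} \<subseteq> (\<lambda>x. x * x mod p) ` {1..<p}"
    using finite_surj_inj[of "{1..<p}"] by blast
  then obtain n where n: "n \<in> {1..<p}" "n \<notin> (\<lambda>x. x * x mod p) ` {1..<p}" by blast
  have nd: "\<not> p dvd n" using n(1) by (auto dest: dvd_imp_le)
  have "\<not> QuadRes (int p) (int n)"
  proof
    assume "QuadRes (int p) (int n)"
    then obtain y where y: "[y\<^sup>2 = int n] (mod int p)" by (auto simp: QuadRes_def)
    define x where "x = nat (y mod int p)"
    have "0 \<le> y mod int p" "y mod int p < int p" using p2 by simp_all
    then have x: "int x = y mod int p" "x < p" by (simp_all add: x_def)
    have "[int x = y] (mod int p)" by (simp add: x cong_def)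
    then have "[int x * int x = y * y] (mod int p)" by (intro cong_mult)
    then have "[int x * int x = int n] (mod int p)"
      using y by (auto simp: power2_eq_square intro: cong_trans)
    then have "[x * x = n] (mod p)" by (simp flip: cong_int_iff)
    then have *: "x * x mod p = n" using n(1) by (simp add: cong_def)
    moreover from this have "x \<noteq> 0" using n(1) by (intro notI) simp
    ultimately show False using n(2) x(2) by (auto simp: image_iff)
  qed
  then have "Legendre (int n) p = - 1" using nd by (simp add: Legendre_def cong_0_iff)
  moreover have "coprime n p" using nd p by (metis coprime_commute prime_imp_coprime)
  ultimately show thesis using that by blast
qed

text \<open>
  Reindex the sum by multiplication with \<open>b\<close>.
\<close>

lemma gauss_sum_power:
  assumes x: "x ^ p = 1" and b: "coprime b p"
  shows "gauss_sum p (x ^ b) = of_int (Legendre (int b) p) * gauss_sum p x"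
proof -
  have "\<not> p dvd b" using b p by (metis coprime_absorb_right not_prime_unit)
  then have sq: "Legendre (int b) p * Legendre (int b) p = 1" by (intro Legendre_square) simp
  have "gauss_sum p x = (\<Sum>a\<in>{1..<p}. of_int (Legendre (int (a * b mod p)) p) * x ^ (a * b mod p))"
    unfolding gauss_sum_def by (rule sum.reindex_bij_betw[OF bij_betw_residues_mult[OF b], symmetric])
  also have "\<dots> = (\<Sum>a\<in>{1..<p}. of_int (Legendre (int a * int b) p) * x ^ (a * b))"
  proof (rule sum.cong)
    fix a
    have "Legendre (int (a * b mod p)) p = Legendre (int a * int b) p"
      by (rule Legendre_cong) (simp add: zmod_int cong_def)
    moreover have "x ^ (a * b mod p) = x ^ (a * b)"
      by (rule power_root_unity_cong[OF x]) (simp add: cong_def)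
    ultimately show "of_int (Legendre (int (a * b mod p)) p) * x ^ (a * b mod p)
        = of_int (Legendre (int a * int b) p) * x ^ (a * b)"
      by simp
  qed simp
  also have "\<dots> = of_int (Legendre (int b) p) * gauss_sum p (x ^ b)"
    unfolding gauss_sum_def sum_distrib_left
    by (rule sum.cong) (simp_all add: Legendre_mult mult_ac flip: power_mult)
  finally have "of_int (Legendre (int b) p) * gauss_sum p x
      = of_int (Legendre (int b) p * Legendre (int b) p) * gauss_sum p (x ^ b)"
    by simp
  then show ?thesis by (simp only: sq) simp
qed

text \<open>
  The Legendre symbols sum to zero, as multiplication with a nonresidue changes the sign of the sum.
\<close>

lemma gauss_sum_one: "gauss_sum p 1 = 0"
proof -
  obtain n where n: "coprime n p" "Legendre (int n) p = - 1" using exists_quadratic_nonresidue by blast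
  have "gauss_sum p 1 - of_int (- 1) * gauss_sum p 1 = 0"
    using gauss_sum_power[OF power_one n(1)] unfolding n(2) power_one by (simp only: right_minus_eq)
  then show ?thesis by simp
qed

lemma sum_primitive_root_powers:
  assumes x: "primitive_root_unity p x"
  shows "(\<Sum>b\<in>{1..<p}. (x ^ c) ^ b) = (if p dvd c then of_nat p - 1 else - 1)"
proof (cases "p dvd c")
  case True
  then have "x ^ c = 1" by (rule primitive_root_unity_eq_1_iff[OF x, THEN iffD2])
  then show ?thesis using True p2 by (simp add: of_nat_diff)
next
  case False
  then have ne: "x ^ c \<noteq> 1" by (simp only: primitive_root_unity_eq_1_iff[OF x] not_False_eq_True)
  have "x ^ p = 1" by (rule primitive_root_unity_power_self[OF x])
  then have "(x ^ c) ^ p = 1" by (metis mult.commute power_mult power_one)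
  then have "(\<Sum>b<p. (x ^ c) ^ b) = 0" using geometric_sum[OF ne, of p] by simp
  moreover have "{..<p} = insert 0 {1..<p}" using p2 by auto
  ultimately have "1 + (\<Sum>b\<in>{1..<p}. (x ^ c) ^ b) = 0" by simp
  then show ?thesis using False by (simp add: add_eq_0_iff)
qed

text \<open>
  Absorbing one factor into the other through \<open>gauss_sum_power\<close> gives a double sum in which, after
  exchanging the summations, only the inner sum for \<open>a = p - 1\<close> differs from \<open>-1\<close>.
\<close>

lemma gauss_sum_squared:
  assumes x: "primitive_root_unity p x"
  shows "(gauss_sum p x)\<^sup>2 = of_int (Legendre (- 1) p * int p)"
proof -
  note xp = primitive_root_unity_power_self[OF x]
  have "(gauss_sum p x)\<^sup>2 = (\<Sum>b\<in>{1..<p}. x ^ b * (of_int (Legendre (int b) p) * gauss_sum p x))"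
  proof -
    have "(gauss_sum p x)\<^sup>2
        = (\<Sum>b\<in>{1..<p}. of_int (Legendre (int b) p) * x ^ b) * gauss_sum p x"
      unfolding power2_eq_square by (subst (1) gauss_sum_def) (rule refl)
    then show ?thesis unfolding sum_distrib_right by (simp only: mult_ac)
  qed
  also have "\<dots> = (\<Sum>b\<in>{1..<p}. x ^ b * gauss_sum p (x ^ b))"
  proof (rule sum.cong)
    fix b assume "b \<in> {1..<p}"
    then have "\<not> p dvd b" by (auto dest: dvd_imp_le)
    then have "coprime b p" using p by (metis coprime_commute prime_imp_coprime)
    then show "x ^ b * (of_int (Legendre (int b) p) * gauss_sum p x) = x ^ b * gauss_sum p (x ^ b)"
      by (simp add: gauss_sum_power[OF xp])
  qed simp
  also have "\<dots> = (\<Sum>b\<in>{1..<p}. \<Sum>a\<in>{1..<p}. of_int (Legendre (int a) p) * (x ^ (a + 1)) ^ b)"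
    by (simp add: gauss_sum_def sum_distrib_left power_add power_mult_distrib mult_ac flip: power_mult)
  also have "\<dots> = (\<Sum>a\<in>{1..<p}. of_int (Legendre (int a) p) * (\<Sum>b\<in>{1..<p}. (x ^ (a + 1)) ^ b))"
    by (subst sum.swap) (simp only: sum_distrib_left)
  also have "\<dots> = (\<Sum>a\<in>{1..<p}. of_int (Legendre (int a) p)
      * ((if a = p - 1 then of_nat p else 0) - 1))"
  proof (intro sum.cong refl arg_cong2[of _ _ _ _ "(*)"])
    fix a assume a: "a \<in> {1..<p}"
    then have "p dvd a + 1 \<longleftrightarrow> a = p - 1" by (auto dest: dvd_imp_le)
    then show "(\<Sum>b\<in>{1..<p}. (x ^ (a + 1)) ^ b) = (if a = p - 1 then of_nat p else 0) - 1"
      unfolding sum_primitive_root_powers[OF x] by simp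
  qed
  also have "\<dots> = (\<Sum>a\<in>{1..<p}. if a = p - 1 then of_int (Legendre (int a) p) * of_nat p else 0)
      - gauss_sum p 1"
    unfolding gauss_sum_def sum_subtractf[symmetric]
    by (rule sum.cong) (simp_all add: algebra_simps)
  also have "\<dots> = of_int (Legendre (int (p - 1)) p) * of_nat p"
    using p2 by (simp add: gauss_sum_one)
  also have "Legendre (int (p - 1)) p = Legendre (- 1) p"
    using p2 by (intro Legendre_cong) (simp add: of_nat_diff cong_iff_dvd_diff)
  finally show ?thesis by simp
qed

end

lemma rational_poly_fun_gauss_sum [rational_poly_fun_intros]:
  "rational_poly_fun f \<Longrightarrow> rational_poly_fun (\<lambda>x. gauss_sum p (f x))"
  unfolding gauss_sum_def by (intro rational_poly_fun_intros Rats_of_int)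

section \<open>Square roots of the prime power\<close>

text \<open>
  Square roots of the same number agree up to sign, and the sign disappears in the rational factor.
\<close>

lemma square_root_rational_multiple:
  fixes x u :: complex
  assumes "x\<^sup>2 = of_int (d * c\<^sup>2)" and "u\<^sup>2 = of_int d"
  obtains e where "e \<in> \<rat>" and "x = e * u"
proof -
  have "x\<^sup>2 = (of_int c * u)\<^sup>2" using assms by (simp add: power_mult_distrib)
  then consider "x = of_int c * u" | "x = of_int (- c) * u" by (auto simp: power2_eq_iff)
  then show thesis using that Rats_of_int by metis
qed

lemma odd_prime_power_form:
  assumes "odd r" and "q = int p ^ r \<or> q = (- int p) ^ r"
  obtains c where "q = int p * c\<^sup>2 \<or> q = - int p * c\<^sup>2"
proof -
  obtain k where k: "r = 2 * k + 1" using assms(1) by (auto elim: oddE)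
  have "int p ^ r = int p * (int p ^ k)\<^sup>2" "(- int p) ^ r = - int p * (int p ^ k)\<^sup>2"
    by (simp_all add: k flip: power_even_eq)
  then show thesis using that assms(2) by metis
qed

text \<open>
  So \<open>Legendre (- 1) p * p\<close> is the one among \<open>p\<close> and \<open>-p\<close> that is congruent to 1 modulo 4.
\<close>

lemma prime_star_mod_4:
  assumes "prime p" and "p > 2"
  shows "[Legendre (- 1) (int p) * int p = 1] (mod 4)"
proof -
  have "odd p" using assms prime_odd_nat by blast
  then have "p mod 4 = 1 \<or> p mod 4 = 3" by presburger
  define k where "k = p div 4"
  then have "p = 4 * k + 1 \<or> p = 4 * k + 3" using \<open>p mod 4 = 1 \<or> p mod 4 = 3\<close> by presburger
  then show ?thesis
  proof
    assume p: "p = 4 * k + 1"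
    then have "(p - 1) div 2 = 2 * k" by simp
    then have "Legendre (- 1) (int p) = 1" by (simp add: Legendre_minus_one[OF assms])
    then show ?thesis by (simp add: p cong_def)
  next
    assume p: "p = 4 * k + 3"
    then have "(p - 1) div 2 = 2 * k + 1" by simp
    then have "Legendre (- 1) (int p) = - 1" by (simp add: Legendre_minus_one[OF assms])
    then have "Legendre (- 1) (int p) * int p = 1 + 4 * (- int k - 1)" by (simp add: p)
    then show ?thesis by (simp add: cong_iff_dvd_diff)
  qed
qed

lemma odd_cong_1_mod_4:
  fixes q :: int
  assumes "odd q"
  shows "[q = 1] (mod 4) \<or> [- q = 1] (mod 4)"
proof -
  obtain k where k: "q = 2 * k + 1" using assms by (rule oddE)
  show ?thesis
  proof (cases "even k")
    case True
    then obtain j where "k = 2 * j" by (rule evenE)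
    then have "q - 1 = 4 * j" by (simp add: k)
    then show ?thesis by (simp add: cong_iff_dvd_diff)
  next
    case False
    then obtain j where "k = 2 * j + 1" by (rule oddE)
    then have "- q - 1 = 4 * (- j - 1)" by (simp add: k)
    then have "4 dvd - q - 1" by (rule dvdI)
    then show ?thesis by (simp add: cong_iff_dvd_diff)
  qed
qed

text \<open>
  Odd squares are congruent to 1 modulo 4, so the sign in front of \<open>p c\<^sup>2\<close> can be read off from \<open>q\<close>
  modulo 4.
\<close>

lemma prime_star_form:
  assumes p: "prime p" "p > 2" and q: "[q = 1] (mod 4)"
    and c: "q = int p * c\<^sup>2 \<or> q = - int p * c\<^sup>2"
  shows "q = Legendre (- 1) (int p) * int p * c\<^sup>2"
proof (rule ccontr)
  assume ne: "q \<noteq> Legendre (- 1) (int p) * int p * c\<^sup>2"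
  have "Legendre (- 1) (int p) = 1 \<or> Legendre (- 1) (int p) = - 1"
    using Legendre_minus_one[OF p] by (cases "even ((p - 1) div 2)") auto
  then have qc: "q = - (Legendre (- 1) (int p) * int p) * c\<^sup>2" using ne c by auto
  have "odd q" using q unfolding cong_def by presburger
  then have "odd c" using c by auto
  then obtain k where k: "c = 2 * k + 1" by (rule oddE)
  have "c\<^sup>2 = 1 + 4 * (k\<^sup>2 + k)" by (simp add: k power2_eq_square algebra_simps)
  then have "[c\<^sup>2 = 1] (mod 4)" by (simp add: cong_iff_dvd_diff)
  then have "[q = - 1 * 1] (mod 4)"
    unfolding qc by (intro cong_mult cong_minus_minus_iff[THEN iffD2] prime_star_mod_4 p)
  then have "[1 = (- 1 :: int)] (mod 4)" using q by (metis cong_sym cong_trans mult.right_neutral)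
  then show False by (simp add: cong_def)
qed

lemma square_roots_of_two_and_minus_two:
  fixes z :: complex
  assumes "z ^ 4 = - 1"
  shows "(z + z ^ 7)\<^sup>2 = 2" and "(z + z ^ 3)\<^sup>2 = - 2"
proof -
  have "(z + z ^ 7)\<^sup>2 = z\<^sup>2 + 2 * (z ^ 4)\<^sup>2 + z\<^sup>2 * (z ^ 4) ^ 3"
    by (simp add: power2_eq_square eval_nat_numeral algebra_simps)
  then show "(z + z ^ 7)\<^sup>2 = 2" by (simp add: assms)
  have "(z + z ^ 3)\<^sup>2 = z\<^sup>2 + 2 * z ^ 4 + z\<^sup>2 * z ^ 4"
    by (simp add: power2_eq_square eval_nat_numeral algebra_simps)
  then show "(z + z ^ 3)\<^sup>2 = - 2" by (simp add: assms)
qed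

text \<open>
  The exponent \<open>k\<close> selects the eighth root that accompanies \<open>z\<close>: its inverse for \<open>\<surd>2\<close> and its cube
  for \<open>\<surd>-2\<close>.
\<close>

lemma square_root_as_sum_of_eighth_roots:
  fixes z s :: complex
  assumes z: "z ^ 4 = - 1" and s: "s\<^sup>2 = of_int q" and q: "q = 2 * c\<^sup>2 \<and> k = 7 \<or> q = - 2 * c\<^sup>2 \<and> k = 3"
  obtains e where "e \<in> \<rat>" and "s = e * (z + z ^ k)"
  using q
proof
  assume q: "q = 2 * c\<^sup>2 \<and> k = 7"
  then have "s\<^sup>2 = of_int (2 * c\<^sup>2)" using s by simp
  then show thesis
    by (rule square_root_rational_multiple[of _ _ _ "z + z ^ k"])
       (use square_roots_of_two_and_minus_two(1)[OF z] q that in simp_all)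
next
  assume q: "q = - 2 * c\<^sup>2 \<and> k = 3"
  then have "s\<^sup>2 = of_int (- 2 * c\<^sup>2)" using s by simp
  then show thesis
    by (rule square_root_rational_multiple[of _ _ _ "z + z ^ k"])
       (use square_roots_of_two_and_minus_two(2)[OF z] q that in simp_all)
qed

section \<open>The normal case\<close>

lemma rat_eval_even_odd: "\<exists>a b. \<forall>x. rat_eval h x = rat_eval a (x\<^sup>2) + x * rat_eval b (x\<^sup>2)"
proof (induction h)
  case 0
  show ?case by (intro exI[of _ 0]) simp
next
  case (pCons c h)
  then obtain a b where "\<And>x. rat_eval h x = rat_eval a (x\<^sup>2) + x * rat_eval b (x\<^sup>2)" by blast
  then have "rat_eval (pCons c h) x = rat_eval (pCons c b) (x\<^sup>2) + x * rat_eval a (x\<^sup>2)" for x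
    by (simp add: algebra_simps power2_eq_square)
  then show ?case by blast
qed

text \<open>
  Every conjugate \<open>y\<close> has \<open>y\<^sup>2 / q\<close> conjugate to \<open>\<zeta>\<^sup>2\<close>, which is primitive of order \<open>2t\<close>; hence \<open>y / s\<close>
  is primitive of order \<open>4t\<close>.  For the converse, split a polynomial that vanishes at \<open>s \<zeta>\<close> into its
  even and odd parts.  As it vanishes at \<open>- (s \<zeta>)\<close> too, both parts give polynomials vanishing at
  \<open>q \<zeta>\<^sup>2\<close>, hence at the conjugate \<open>q z\<^sup>2\<close>, and the polynomial itself vanishes at \<open>s z\<close>.
\<close>

lemma rational_conjugates_sqrt_times_root:
  fixes q :: int
  assumes s: "s\<^sup>2 = of_int q" "q \<noteq> 0" and t: "t > 0"
    and \<zeta>: "primitive_root_unity (4 * t) \<zeta>"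
    and neg: "rational_conjugate (s * \<zeta>) (- (s * \<zeta>))"
  shows "{y. rational_conjugate (s * \<zeta>) y} = (\<lambda>z. s * z) ` {z. primitive_root_unity (4 * t) z}"
proof safe
  fix y assume conj: "rational_conjugate (s * \<zeta>) y"
  define f :: "complex \<Rightarrow> complex" where "f = (\<lambda>x. inverse (of_int q) * x\<^sup>2)"
  have f: "rational_poly_fun f" unfolding f_def by (intro rational_poly_fun_intros) auto
  have s0: "s \<noteq> 0" using s by auto
  have fs: "f (s * z) = z\<^sup>2" for z using s by (simp add: f_def power_mult_distrib)
  have "primitive_root_unity (2 * t) (\<zeta>\<^sup>2)"
    using primitive_root_unity_power[of 2 "2 * t" \<zeta> 2] \<zeta> by simp
  moreover have "rational_conjugate (\<zeta>\<^sup>2) (f y)"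
    using rational_conjugate_poly_fun[OF conj f] by (simp add: fs)
  ultimately have "primitive_root_unity (2 * t) (f y)" by (rule primitive_root_unity_conjugate)
  moreover have "f y = (y / s)\<^sup>2" using fs[of "y / s"] s0 by simp
  ultimately have "primitive_root_unity (4 * t) (y / s)"
    by (simp only: primitive_root_unity_sqrt)
  moreover have "y = s * (y / s)" using s0 by simp
  ultimately show "y \<in> (\<lambda>z. s * z) ` {z. primitive_root_unity (4 * t) z}" by blast
next
  fix z assume z: "primitive_root_unity (4 * t) z"
  have conj: "rational_conjugate \<zeta> z" by (rule rational_conjugate_primitive_roots[OF \<zeta> z])
  show "rational_conjugate (s * \<zeta>) (s * z)"
    unfolding rational_conjugate_def
  proof (intro allI impI)
    fix h assume h: "rat_eval h (s * \<zeta>) = 0"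
    obtain a b where ab: "\<And>x. rat_eval h x = rat_eval a (x\<^sup>2) + x * rat_eval b (x\<^sup>2)"
      using rat_eval_even_odd by blast
    have "\<zeta> \<noteq> 0" using \<zeta> t by (auto simp: primitive_root_unity_def power_0_left)
    then have nz: "s * \<zeta> \<noteq> 0" using s by auto
    have "rat_eval h (- (s * \<zeta>)) = 0" by (rule rational_conjugateD[OF neg h])
    then have "rat_eval a ((s * \<zeta>)\<^sup>2) = 0" "rat_eval b ((s * \<zeta>)\<^sup>2) = 0"
      using h nz by (simp_all add: ab add_eq_0_iff)
    moreover have "rational_conjugate ((s * \<zeta>)\<^sup>2) ((s * z)\<^sup>2)"
      unfolding power_mult_distrib s
      by (rule rational_conjugate_poly_fun[OF conj]) (intro rational_poly_fun_intros Rats_of_int)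
    ultimately show "rat_eval h (s * z) = 0"
      by (simp add: ab rational_conjugateD)
  qed
qed

text \<open>
  If \<open>s\<close> is an even polynomial in \<open>\<zeta>\<close>, replacing \<open>\<zeta>\<close> by its conjugate \<open>-\<zeta>\<close> fixes \<open>s\<close>.
\<close>

lemma rational_conjugate_uminus_even:
  assumes \<zeta>: "primitive_root_unity (4 * t) \<zeta>"
    and h: "rational_poly_fun h" "h \<zeta> = s" "h (- \<zeta>) = s"
  shows "rational_conjugate (s * \<zeta>) (- (s * \<zeta>))"
proof -
  have "rational_conjugate \<zeta> (- \<zeta>)"
    by (rule rational_conjugate_primitive_roots[OF \<zeta> primitive_root_unity_uminus[OF \<zeta>]])
  then have "rational_conjugate (h \<zeta> * \<zeta>) (h (- \<zeta>) * (- \<zeta>))"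
    by (rule rational_conjugate_poly_fun) (intro rational_poly_fun_intros h(1))
  then show ?thesis by (simp add: h)
qed

text \<open>
  As \<open>4t\<close> and \<open>p\<close> are coprime, \<open>\<zeta>\<close> and \<open>\<xi>\<close> can be moved independently.  Fix \<open>\<zeta>\<close> and replace \<open>\<xi>\<close> by \<open>\<xi>\<^sup>n\<close>
  for a quadratic nonresidue \<open>n\<close>: this changes the sign of the Gauss sum.
\<close>

lemma rational_conjugate_uminus_gauss_sum:
  assumes p: "prime p" "p > 2" and pt: "\<not> p dvd t"
    and \<zeta>: "primitive_root_unity (4 * t) \<zeta>" and \<xi>: "primitive_root_unity p \<xi>"
    and h: "rational_poly_fun h" and s: "s = h \<zeta> * gauss_sum p \<xi>"
  shows "rational_conjugate (s * \<zeta>) (- (s * \<zeta>))"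
proof -
  have "odd p" using p prime_odd_nat by blast
  then have "coprime p (2\<^sup>2)"
    by (simp only: coprime_power_right_iff coprime_right_2_iff_odd) simp
  then have "coprime p 4" by simp
  moreover have "coprime p t" using p(1) pt by (rule prime_imp_coprime)
  ultimately have cop: "coprime (4 * t) p" by (simp add: coprime_commute)
  obtain n where n: "coprime n p" "Legendre (int n) p = - 1" using exists_quadratic_nonresidue[OF p] by blast
  have \<xi>n: "primitive_root_unity p (\<xi> ^ n)"
    using primitive_root_unity_power[of 1 p \<xi> n] \<xi> n(1) by simp
  obtain i j where ij: "[i = 1] (mod 4 * t)" "[i = 0] (mod p)" "[j = 0] (mod 4 * t)" "[j = 1] (mod p)"
    by (rule coprime_exponents[OF cop])
  define f where "f = (\<lambda>x. h (x ^ i) * gauss_sum p (x ^ j) * x ^ i)"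
  have f: "rational_poly_fun f"
    unfolding f_def by (intro rational_poly_fun_intros rational_poly_fun_compose[OF h])
  have split: "(\<zeta> * x) ^ i = \<zeta>" "(\<zeta> * x) ^ j = x" if "primitive_root_unity p x" for x
    using primitive_root_unity_mult_recover_factor[OF \<zeta> that ij(1,2)]
      primitive_root_unity_mult_recover_factor[OF that \<zeta> ij(4,3)] by (simp_all add: mult.commute)
  have "rational_conjugate (\<zeta> * \<xi>) (\<zeta> * \<xi> ^ n)"
    by (rule rational_conjugate_primitive_roots; rule primitive_root_unity_mult[OF cop \<zeta>])
       (rule \<xi> \<xi>n)+
  then have "rational_conjugate (f (\<zeta> * \<xi>)) (f (\<zeta> * \<xi> ^ n))"
    by (rule rational_conjugate_poly_fun) (rule f)
  moreover have "f (\<zeta> * \<xi>) = s * \<zeta>" by (simp add: f_def split[OF \<xi>] s)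
  moreover have "f (\<zeta> * \<xi> ^ n) = - (s * \<zeta>)"
    using gauss_sum_power[OF p primitive_root_unity_power_self[OF \<xi>] n(1)]
    by (simp add: f_def split[OF \<xi>n] s n(2))
  ultimately show ?thesis by simp
qed

text \<open>
  For \<open>q \<equiv> 1 (mod 4)\<close> the number \<open>s\<close> is a rational multiple of the Gauss sum; otherwise \<open>-q\<close> is
  congruent to 1 and a factor \<open>\<zeta>\<^sup>t\<close>, a square root of \<open>-1\<close>, is needed.  If \<open>p\<close> does not divide \<open>t\<close>, the
  Gauss sum is independent of \<open>\<zeta>\<close>.  If it does, the Gauss sum is an even polynomial in \<open>\<zeta>\<close>, and the
  factor \<open>\<zeta>\<^sup>t\<close> is even or absent by the assumption on \<open>t\<close> and \<open>q\<close>.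
\<close>

lemma rational_conjugate_uminus_odd:
  fixes q :: int
  assumes p: "prime p" "p > 2" and q: "q = int p * c\<^sup>2 \<or> q = - int p * c\<^sup>2" "odd q"
    and s: "s\<^sup>2 = of_int q" and \<zeta>: "primitive_root_unity (4 * t) \<zeta>"
    and normal: "even t \<or> \<not> p dvd t \<or> [q = 1] (mod 4)"
  shows "rational_conjugate (s * \<zeta>) (- (s * \<zeta>))"
proof -
  define d where "d = Legendre (- 1) (int p) * int p"
  note t = primitive_root_unity_gt_0[OF \<zeta>]
  have i: "(\<zeta> ^ t)\<^sup>2 = - 1"
    using primitive_root_unity_half[of "2 * t" \<zeta>] \<zeta> by (simp add: mult.commute flip: power_mult)
  have root: "\<exists>h. rational_poly_fun h \<and> s = h \<zeta> * gauss_sum p \<xi> \<and> (h (- \<zeta>) = h \<zeta> \<or> odd t \<and> \<not> [q = 1] (mod 4))"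
    if \<xi>: "primitive_root_unity p \<xi>" for \<xi>
  proof (cases "[q = 1] (mod 4)")
    case True
    then have "q = d * c\<^sup>2" unfolding d_def by (rule prime_star_form[OF p _ q(1)])
    then have "s\<^sup>2 = of_int (d * c\<^sup>2)" using s by simp
    then obtain e where e: "e \<in> \<rat>" "s = e * gauss_sum p \<xi>"
      by (rule square_root_rational_multiple) (use gauss_sum_squared[OF p \<xi>] in \<open>simp add: d_def\<close>)
    show ?thesis
      by (rule exI[of _ "\<lambda>x. e"]) (use e rational_poly_fun_const in simp)
  next
    case False
    then have "[- q = 1] (mod 4)" using odd_cong_1_mod_4[OF q(2)] by blast
    moreover have "- q = int p * c\<^sup>2 \<or> - q = - int p * c\<^sup>2" using q(1) by auto
    ultimately have "- q = d * c\<^sup>2" unfolding d_def by (rule prime_star_form[OF p])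
    then have "(s * \<zeta> ^ t)\<^sup>2 = of_int (d * c\<^sup>2)"
      unfolding power_mult_distrib i s by (metis mult_minus1_right of_int_minus)
    then obtain e where e: "e \<in> \<rat>" "s * \<zeta> ^ t = e * gauss_sum p \<xi>"
      by (rule square_root_rational_multiple) (use gauss_sum_squared[OF p \<xi>] in \<open>simp add: d_def\<close>)
    have "s * (\<zeta> ^ t)\<^sup>2 = e * gauss_sum p \<xi> * \<zeta> ^ t"
      by (simp add: power2_eq_square e(2) flip: mult.assoc)
    then have "- s = e * gauss_sum p \<xi> * \<zeta> ^ t" unfolding i by simp
    then have "- (- s) = - (e * gauss_sum p \<xi> * \<zeta> ^ t)" by (rule arg_cong)
    then have "s = (- e * \<zeta> ^ t) * gauss_sum p \<xi>" by (simp add: mult_ac)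
    moreover have "rational_poly_fun (\<lambda>x. - e * x ^ t)"
      using e(1) by (intro rational_poly_fun_intros) auto
    moreover have "- e * (- \<zeta>) ^ t = - e * \<zeta> ^ t \<or> odd t" by (cases "even t") simp_all
    ultimately show ?thesis using False by blast
  qed
  show ?thesis
  proof (cases "p dvd t")
    case False
    obtain \<xi> where \<xi>: "primitive_root_unity p \<xi>"
      using primitive_root_unity_exists[of p] p(2) by auto
    obtain h where "rational_poly_fun h" "s = h \<zeta> * gauss_sum p \<xi>" using root[OF \<xi>] by blast
    then show ?thesis by (rule rational_conjugate_uminus_gauss_sum[OF p False \<zeta> \<xi>])
  next
    case True
    then obtain u where u: "t = p * u" by (blast elim: dvdE)
    have \<xi>: "primitive_root_unity p (\<zeta> ^ (4 * u))"
      using primitive_root_unity_power[of "4 * u" p \<zeta> "4 * u"] \<zeta> u by (simp add: mult_ac)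
    obtain h where h: "rational_poly_fun h" "s = h \<zeta> * gauss_sum p (\<zeta> ^ (4 * u))" "h (- \<zeta>) = h \<zeta>"
      using root[OF \<xi>] normal True by blast
    show ?thesis
    proof (rule rational_conjugate_uminus_even[OF \<zeta>, of "\<lambda>x. h x * gauss_sum p (x ^ (4 * u))"])
      show "rational_poly_fun (\<lambda>x. h x * gauss_sum p (x ^ (4 * u)))"
        by (intro rational_poly_fun_intros h(1))
      show "h \<zeta> * gauss_sum p (\<zeta> ^ (4 * u)) = s" using h(2) by simp
      have "(- \<zeta>) ^ (4 * u) = \<zeta> ^ (4 * u)" by (rule power_minus_even) simp
      then show "h (- \<zeta>) * gauss_sum p ((- \<zeta>) ^ (4 * u)) = s" using h(2,3) by simp
    qed
  qed
qed

text \<open>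
  If 4 divides \<open>t\<close>, then \<open>\<zeta>\<^sup>t\<^sup>/\<^sup>2\<close> is a primitive eighth root of unity and \<open>s\<close> is an even polynomial in
  \<open>\<zeta>\<close>.  If \<open>t\<close> is odd, take a square root \<open>w\<close> of \<open>\<zeta>\<close>, primitive of order \<open>8t\<close>: the conjugation
  \<open>w \<mapsto> -w\<close> fixes \<open>\<zeta> = w\<^sup>2\<close> and changes the sign of the eighth root \<open>w\<^sup>t\<close>, hence of \<open>s\<close>.
\<close>

lemma rational_conjugate_uminus_two:
  fixes q :: int
  assumes q: "q = 2 * c\<^sup>2 \<or> q = - 2 * c\<^sup>2"
    and s: "s\<^sup>2 = of_int q" and \<zeta>: "primitive_root_unity (4 * t) \<zeta>"
    and normal: "\<not> [t = 2] (mod 4)"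
  shows "rational_conjugate (s * \<zeta>) (- (s * \<zeta>))"
proof -
  obtain k where k: "odd k" "q = 2 * c\<^sup>2 \<and> k = 7 \<or> q = - 2 * c\<^sup>2 \<and> k = (3::nat)"
    using q by (metis odd_numeral)
  have "odd t \<or> 4 dvd t" using normal unfolding cong_def by presburger
  then show ?thesis
  proof
    assume "4 dvd t"
    then obtain u where u: "t = 4 * u" by (blast elim: dvdE)
    have "\<zeta> ^ (8 * u) = - 1"
      using primitive_root_unity_half[of "8 * u" \<zeta>] \<zeta> u by simp
    then have "(\<zeta> ^ (2 * u)) ^ 4 = - 1" by (simp add: mult.commute flip: power_mult)
    then obtain e where e: "e \<in> \<rat>" "s = e * (\<zeta> ^ (2 * u) + (\<zeta> ^ (2 * u)) ^ k)"
      using square_root_as_sum_of_eighth_roots[OF _ s k(2)] by blast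
    show ?thesis
    proof (rule rational_conjugate_uminus_even[OF \<zeta>])
      show "rational_poly_fun (\<lambda>x. e * (x ^ (2 * u) + (x ^ (2 * u)) ^ k))"
        using e(1) by (intro rational_poly_fun_intros)
    qed (simp_all add: e(2))
  next
    assume t: "odd t"
    define w where "w = csqrt \<zeta>"
    have w2: "w\<^sup>2 = \<zeta>" by (simp add: w_def)
    have w: "primitive_root_unity (4 * (2 * t)) w"
      using primitive_root_unity_sqrt[of "2 * t" w] \<zeta> by (simp add: w2)
    have "w ^ (4 * t) = - 1"
      using primitive_root_unity_half[of "4 * t" w] w by simp
    then have "(w ^ t) ^ 4 = - 1" by (simp add: mult.commute flip: power_mult)
    then obtain e where e: "e \<in> \<rat>" "s = e * (w ^ t + (w ^ t) ^ k)"
      using square_root_as_sum_of_eighth_roots[OF _ s k(2)] by blast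
    define f where "f = (\<lambda>x. e * (x ^ t + (x ^ t) ^ k) * x\<^sup>2)"
    have "rational_conjugate w (- w)"
      by (rule rational_conjugate_primitive_roots[OF w primitive_root_unity_uminus[OF w]])
    then have "rational_conjugate (f w) (f (- w))"
      by (rule rational_conjugate_poly_fun) (use e(1) in \<open>unfold f_def, intro rational_poly_fun_intros\<close>)
    moreover have "f w = s * \<zeta>" by (simp only: f_def e(2) w2)
    moreover have "f (- w) = - f w"
      using t k(1) by (simp add: f_def algebra_simps)
    ultimately show ?thesis by simp
  qed
qed

section \<open>The exceptional cases\<close>

text \<open>
  Here \<open>s\<close> is a rational multiple of the Gauss sum of the \<open>p\<close>-th root of unity \<open>z\<^sup>u\<close>, so \<open>s z\<close> is a
  polynomial in \<open>z\<close>.  Conversely \<open>(s z)\<^sup>2 / q = z\<^sup>2\<close>, and \<open>z\<close> is a power of \<open>z\<^sup>2\<close> because \<open>t\<close> is odd.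
\<close>

lemma is_min_poly_rat_Psi_odd:
  fixes q :: int
  assumes p: "prime p" "p > 2" and q: "q = int p * c\<^sup>2 \<or> q = - int p * c\<^sup>2" "[q = 1] (mod 4)"
    and s: "s\<^sup>2 = of_int q" and z: "primitive_root_unity t z" and t: "odd t" "p dvd t"
  shows "is_min_poly_rat (scale_poly s (Psi_odd p (t div p) z)) (s * z)"
proof -
  obtain u where u: "t = p * u" using t(2) by (blast elim: dvdE)
  have \<xi>: "primitive_root_unity p (z ^ u)"
    using primitive_root_unity_power[of u p z u] z u by (simp add: mult.commute)
  have q0: "q \<noteq> 0" using q(2) by (auto simp: cong_def)
  then have s0: "s \<noteq> 0" using s by auto
  have "s\<^sup>2 = of_int (Legendre (- 1) (int p) * int p * c\<^sup>2)"
    using s prime_star_form[OF p q(2,1)] by simp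
  then obtain e where e: "e \<in> \<rat>" "s = e * gauss_sum p (z ^ u)"
    by (rule square_root_rational_multiple) (use gauss_sum_squared[OF p \<xi>] in simp)
  define f where "f = (\<lambda>x. e * gauss_sum p (x ^ u) * x)"
  define m where "m = (t + 1) div 2"
  have m: "2 * m = t + 1" using t(1) by (simp add: m_def)
  define g where "g = (\<lambda>x. (inverse (of_int q) * x\<^sup>2) ^ m :: complex)"
  define L where "L = (\<lambda>a. of_int (Legendre (int a) (int p)) :: complex)"
  have root_square: "(w\<^sup>2) ^ m = w" if "w ^ t = 1" for w :: complex
    using that by (simp add: m flip: power_mult)
  note zt = primitive_root_unity_power_self[OF z]
  have tot: "L a * L a = 1 \<and> f (z ^ a) = s * (L a * z ^ a)" if "a \<in> totatives t" for a
  proof -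
    have cop: "coprime a p" using that u by (simp add: in_totatives_iff)
    have "\<not> p dvd a" using cop p(1) by (metis coprime_absorb_right not_prime_unit)
    then have "Legendre (int a) (int p) * Legendre (int a) (int p) = 1"
      by (intro Legendre_square[OF p]) simp
    moreover have "gauss_sum p ((z ^ u) ^ a) = L a * gauss_sum p (z ^ u)"
      unfolding L_def by (rule gauss_sum_power[OF p primitive_root_unity_power_self[OF \<xi>] cop])
    then have "f (z ^ a) = s * (L a * z ^ a)"
      by (simp add: f_def e(2) mult_ac flip: power_mult)
    ultimately show ?thesis unfolding L_def by (metis of_int_1 of_int_mult)
  qed
  have bij: "bij_betw (\<lambda>a. z ^ a) (totatives t) {x. primitive_root_unity t x}"
    by (rule primitive_root_unity_totatives[OF z])
  have "{y. rational_conjugate (s * z) y} = f ` {x. primitive_root_unity t x}"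
  proof (rule rational_conjugates_cyclotomic_generator[OF z])
    show "rational_poly_fun f" "rational_poly_fun g"
      unfolding f_def g_def using e(1) by (intro rational_poly_fun_intros; simp)+
    show "f z = s * z" by (simp add: f_def e(2))
    have "inverse (of_int q) * (s * z)\<^sup>2 = z\<^sup>2" using q0 by (simp add: power_mult_distrib s)
    then show "g (s * z) = z" unfolding g_def by (simp only: root_square[OF zt])
  qed
  also have "{x. primitive_root_unity t x} = (\<lambda>a. z ^ a) ` totatives t"
    using bij by (simp add: bij_betw_def)
  also have "f ` (\<lambda>a. z ^ a) ` totatives t = (\<lambda>a. s * (L a * z ^ a)) ` totatives t"
    unfolding image_image using tot by (intro image_cong refl) blast
  finally have conj: "{y. rational_conjugate (s * z) y} = (\<lambda>a. s * (L a * z ^ a)) ` totatives t" .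
  have inj: "inj_on (\<lambda>a. L a * z ^ a) (totatives t)"
  proof (rule inj_onI)
    fix a b assume ab: "a \<in> totatives t" "b \<in> totatives t" "L a * z ^ a = L b * z ^ b"
    have sq: "(L x * z ^ x)\<^sup>2 = (z ^ x)\<^sup>2" if "x \<in> totatives t" for x
      using tot[OF that] by (simp add: power_mult_distrib) (simp add: power2_eq_square)
    have "(z ^ a)\<^sup>2 = (z ^ b)\<^sup>2" using sq ab by metis
    then have "((z ^ a)\<^sup>2) ^ m = ((z ^ b)\<^sup>2) ^ m" by (rule arg_cong)
    moreover have "((z ^ x)\<^sup>2) ^ m = z ^ x" for x
      by (rule root_square) (metis zt mult.commute power_mult power_one)
    ultimately have "z ^ a = z ^ b" by simp
    then show "a = b" using bij ab(1,2) by (auto simp: bij_betw_def dest: inj_onD)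
  qed
  have "p * (t div p) = t" using t(2) by simp
  then show ?thesis
    unfolding Psi_odd_def using is_min_poly_rat_scale_poly_prod[OF s0 finite_totatives inj conj]
    by (simp only: L_def)
qed

lemma odd_square_mod_8:
  fixes s :: nat
  assumes "odd s"
  obtains k where "s\<^sup>2 = 8 * k + 1"
proof -
  obtain k where k: "s = 2 * k + 1" using assms by (rule oddE)
  have "even (k * (k + 1))" by simp
  then obtain j where "k * (k + 1) = 2 * j" by (rule evenE)
  then have "s\<^sup>2 = 8 * j + 1" by (simp add: k power2_eq_square algebra_simps)
  then show thesis by (rule that)
qed

text \<open>
  The generator is \<open>w = z8\<^sup>2 z\<close>, primitive of order \<open>4s\<close>.  Since \<open>r\<close> is a rational multiple of
  \<open>z8 + z8\<^sup>k\<close>, the product \<open>r z8\<close> lies in the field of \<open>z8\<^sup>2\<close>, and the exponents \<open>i\<close> and \<open>j\<close> express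
  \<open>r z8 z\<close> as a polynomial in \<open>w\<close>.  Conversely \<open>(r z8 z)\<^sup>2 / q = z8\<^sup>2 z\<^sup>2\<close>, and the \<open>m\<close>-th power of this
  is \<open>w\<close> for \<open>m = (1 + s\<^sup>2) / 2\<close>, as \<open>m \<equiv> 1 (mod 4)\<close> and \<open>2m \<equiv> 1 (mod s)\<close>.  The conjugates of \<open>w\<close> are
  the products \<open>\<plusminus>z8\<^sup>2 y\<close> with \<open>y\<close> primitive of order \<open>s\<close>, and the two signs yield \<open>r z8 y\<close> and
  \<open>r z8\<^sup>k y\<close>.
\<close>

lemma is_min_poly_rat_Psi_even:
  fixes q :: int
  assumes q: "q = 2 * c\<^sup>2 \<and> k = 7 \<or> q = - 2 * c\<^sup>2 \<and> k = 3" "q \<noteq> 0"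
    and r: "r\<^sup>2 = of_int q" and z8: "primitive_root_unity 8 z8" and z: "primitive_root_unity s z"
    and s: "odd s"
  shows "is_min_poly_rat (scale_poly r
    (\<Prod>a\<in>totatives s. [:- (z8 * z ^ a), 1:] * [:- (z8 ^ k * z ^ a), 1:])) (r * (z8 * z))"
proof -
  have z84: "z8 ^ 4 = - 1" using primitive_root_unity_half[of 4 z8] z8 by simp
  obtain e where e: "e \<in> \<rat>" "r = e * (z8 + z8 ^ k)"
    using square_root_as_sum_of_eighth_roots[OF z84 r q(1)] by blast
  have r0: "r \<noteq> 0" using r q(2) by auto
  have i2: "(z8\<^sup>2)\<^sup>2 = - 1" using z84 by (simp flip: power_mult)
  define \<sigma> :: complex where "\<sigma> = (if k = 7 then 1 else - 1)"
  have k2: "z8 * z8 ^ k = \<sigma>" "z8 ^ k * z8 ^ k = - (z8\<^sup>2)"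
  proof -
    have "z8 * z8 ^ 7 = z8 ^ 4 * z8 ^ 4" "z8 ^ 7 * z8 ^ 7 = z8\<^sup>2 * (z8 ^ 4 * z8 ^ 4 * z8 ^ 4)"
      "z8 * z8 ^ 3 = z8 ^ 4" "z8 ^ 3 * z8 ^ 3 = z8\<^sup>2 * z8 ^ 4"
      by (simp_all flip: power_add power_Suc)
    then show "z8 * z8 ^ k = \<sigma>" "z8 ^ k * z8 ^ k = - (z8\<^sup>2)"
      using q(1) by (auto simp: z84 \<sigma>_def)
  qed
  \<comment> \<open>Changing the sign of \<open>z8\<^sup>2\<close> turns \<open>r z8\<close> into \<open>r z8\<^sup>k\<close>.\<close>
  have rz: "r * z8 = e * (z8\<^sup>2 + \<sigma>)" "r * z8 ^ k = e * (- (z8\<^sup>2) + \<sigma>)"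
    using k2 by (simp_all add: e(2) power2_eq_square algebra_simps)
  have cop: "coprime 4 s"
  proof -
    have "coprime (2\<^sup>2) s" using s by (simp only: coprime_power_left_iff coprime_left_2_iff_odd) simp
    then show ?thesis by simp
  qed
  obtain i j where ij: "[i = 1] (mod 4)" "[i = 0] (mod s)" "[j = 0] (mod 4)" "[j = 1] (mod s)"
    by (rule coprime_exponents[OF cop])
  have four: "primitive_root_unity 4 x \<longleftrightarrow> x = z8\<^sup>2 \<or> x = - (z8\<^sup>2)" for x
  proof
    assume "primitive_root_unity 4 x"
    then have "x\<^sup>2 = - 1" using primitive_root_unity_half[of 2 x] by simp
    then show "x = z8\<^sup>2 \<or> x = - (z8\<^sup>2)" using i2 by (metis power2_eq_iff)
  next
    have "primitive_root_unity (4 * 1) (z8\<^sup>2)"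
      using primitive_root_unity_power[of 2 4 z8 2] z8 by simp
    moreover from this have "primitive_root_unity (4 * 1) (- (z8\<^sup>2))"
      by (rule primitive_root_unity_uminus)
    moreover assume "x = z8\<^sup>2 \<or> x = - (z8\<^sup>2)"
    ultimately show "primitive_root_unity 4 x" by auto
  qed
  have recover: "(x * y) ^ i = x" "(x * y) ^ j = y"
    if x: "primitive_root_unity 4 x" and y: "primitive_root_unity s y" for x y
    using primitive_root_unity_mult_recover_factor[OF x y ij(1,2)]
      primitive_root_unity_mult_recover_factor[OF y x ij(4,3)] by (simp_all add: mult.commute)
  have roots: "{x. primitive_root_unity (4 * s) x}
      = (\<lambda>(x, y). x * y) ` ({x. primitive_root_unity 4 x} \<times> {y. primitive_root_unity s y})"
  proof safe
    fix x y assume "primitive_root_unity 4 x" "primitive_root_unity s y"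
    then show "primitive_root_unity (4 * s) (x * y)" by (rule primitive_root_unity_mult[OF cop])
  next
    fix w assume "primitive_root_unity (4 * s) w"
    then obtain x y where "primitive_root_unity 4 x" "primitive_root_unity s y" "w = x * y"
      by (rule primitive_root_unity_split[OF cop])
    then show "w \<in> (\<lambda>(x, y). x * y)
        ` ({x. primitive_root_unity 4 x} \<times> {y. primitive_root_unity s y})"
      by (intro image_eqI[of _ _ "(x, y)"]) simp_all
  qed
  have bij: "bij_betw (\<lambda>a. z ^ a) (totatives s) {x. primitive_root_unity s x}"
    by (rule primitive_root_unity_totatives[OF z])
  define f where "f = (\<lambda>x. e * (x ^ i + \<sigma>) * x ^ j)"
  define m where "m = (1 + s\<^sup>2) div 2"
  define g where "g = (\<lambda>x. (inverse (of_int q) * x\<^sup>2) ^ m :: complex)"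
  have f: "f (x * y) = e * (x + \<sigma>) * y"
    if "primitive_root_unity 4 x" "primitive_root_unity s y" for x y
    unfolding f_def recover[OF that] ..
  have four_z8: "primitive_root_unity 4 (z8\<^sup>2)" by (simp add: four)
  have w: "primitive_root_unity (4 * s) (z8\<^sup>2 * z)"
    by (rule primitive_root_unity_mult[OF cop four_z8 z])
  have "{y. rational_conjugate (r * (z8 * z)) y} = f ` {x. primitive_root_unity (4 * s) x}"
  proof (rule rational_conjugates_cyclotomic_generator[OF w])
    have "\<sigma> \<in> \<rat>" by (simp add: \<sigma>_def)
    then show "rational_poly_fun f" "rational_poly_fun g"
      unfolding f_def g_def using e(1) by (intro rational_poly_fun_intros; simp)+
    show "f (z8\<^sup>2 * z) = r * (z8 * z)"
      using rz(1) f[OF four_z8 z] by (simp add: mult.assoc[symmetric])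
    have m: "2 * m = 1 + s\<^sup>2" using s by (simp add: m_def)
    obtain l where "s\<^sup>2 = 8 * l + 1" by (rule odd_square_mod_8[OF s])
    then have "m = 1 + 4 * l" using m by simp
    then have "[m = 1] (mod 4)" by (simp add: cong_def)
    then have "(z8\<^sup>2) ^ m = (z8\<^sup>2) ^ 1"
      by (rule power_root_unity_cong[OF primitive_root_unity_power_self[OF four_z8]])
    moreover have "[1 + s\<^sup>2 = 1 + 0] (mod s)"
      by (intro cong_add cong_refl) (simp add: cong_def power2_eq_square)
    then have "z ^ (2 * m) = z ^ 1"
      unfolding m by (intro power_root_unity_cong[OF primitive_root_unity_power_self[OF z]]) simp
    moreover have "inverse (of_int q) * (r * (z8 * z))\<^sup>2 = z8\<^sup>2 * z\<^sup>2"
      using q(2) by (simp add: power_mult_distrib r)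
    then have "g (r * (z8 * z)) = (z8\<^sup>2) ^ m * (z\<^sup>2) ^ m"
      unfolding g_def by (simp only: power_mult_distrib)
    ultimately show "g (r * (z8 * z)) = z8\<^sup>2 * z"
      by (simp only: power_mult power_one_right)
  qed
  also have "\<dots> = (\<lambda>(a, j). r * (z8 ^ j * z ^ a)) ` (totatives s \<times> {1, k})"
  proof -
    have "f ` {x. primitive_root_unity (4 * s) x} = (\<lambda>(x, y). e * (x + \<sigma>) * y)
        ` ({x. primitive_root_unity 4 x} \<times> {y. primitive_root_unity s y})"
      unfolding roots image_image using f by (intro image_cong refl) auto
    also have "{x. primitive_root_unity 4 x} = {z8\<^sup>2, - (z8\<^sup>2)}" using four by auto
    also have "{y. primitive_root_unity s y} = (\<lambda>a. z ^ a) ` totatives s"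
      using bij by (simp add: bij_betw_def)
    also have "{z8\<^sup>2, - (z8\<^sup>2)} \<times> (\<lambda>a. z ^ a) ` totatives s
        = (\<lambda>a. (z8\<^sup>2, z ^ a)) ` totatives s \<union> (\<lambda>a. (- (z8\<^sup>2), z ^ a)) ` totatives s"
      by auto
    also have "(\<lambda>(x, y). e * (x + \<sigma>) * y) ` \<dots>
        = (\<lambda>a. r * (z8 ^ 1 * z ^ a)) ` totatives s \<union> (\<lambda>a. r * (z8 ^ k * z ^ a)) ` totatives s"
      unfolding image_Un image_image case_prod_conv rz[symmetric] by (simp only: mult.assoc power_one_right)
    also have "\<dots> = (\<lambda>(a, j). r * (z8 ^ j * z ^ a))
        ` ((\<lambda>a. (a, 1)) ` totatives s \<union> (\<lambda>a. (a, k)) ` totatives s)"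
      unfolding image_Un image_image case_prod_conv ..
    also have "(\<lambda>a. (a, 1)) ` totatives s \<union> (\<lambda>a. (a, k)) ` totatives s = totatives s \<times> {1, k}"
      by auto
    finally show ?thesis .
  qed
  finally have conj: "{y. rational_conjugate (r * (z8 * z)) y}
      = (\<lambda>i. r * (case i of (a, j) \<Rightarrow> z8 ^ j * z ^ a)) ` (totatives s \<times> {1, k})"
    by (simp add: case_prod_unfold)
  have "inj_on (\<lambda>(a, j). z8 ^ j * z ^ a) (totatives s \<times> {1, k})"
  proof (rule inj_onI, clarify)
    fix a j b l
    assume ab: "a \<in> totatives s" "b \<in> totatives s" and jl: "j \<in> {1, k}" "l \<in> {1, k}"
      and eq: "z8 ^ j * z ^ a = z8 ^ l * z ^ b"
    have z80: "z8 \<noteq> 0" using z84 by auto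
    have zs: "(z ^ x) ^ s = 1" for x
      by (metis primitive_root_unity_power_self[OF z] mult.commute power_mult power_one)
    have sq: "(z8 ^ j) ^ 2 = (if j = 1 then z8\<^sup>2 else - (z8\<^sup>2))" if "j \<in> {1, k}" for j
      using that k2(2) by (auto simp: power2_eq_square)
    \<comment> \<open>Squaring and raising to the power \<open>s\<close> removes \<open>z\<close>; as \<open>s\<close> is odd, the sign of \<open>(z8\<^sup>j)\<^sup>2\<close> survives.\<close>
    have "((z8 ^ j) ^ 2) ^ s = ((z8 ^ l) ^ 2) ^ s"
    proof -
      have "((z8 ^ i * z ^ x)\<^sup>2) ^ s = ((z8 ^ i) ^ 2) ^ s" for i x
      proof -
        have "((z ^ x)\<^sup>2) ^ s = ((z ^ x) ^ s)\<^sup>2" by (metis mult.commute power_mult)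
        then show ?thesis by (simp only: power_mult_distrib zs power_one mult_1_right)
      qed
      then show ?thesis using eq by metis
    qed
    then have "j = 1 \<longleftrightarrow> l = 1"
      using z80 s unfolding sq[OF jl(1)] sq[OF jl(2)] by (auto split: if_splits)
    then have "j = l" using jl by auto
    then have "z ^ a = z ^ b" using eq z80 by simp
    then show "a = b \<and> j = l" using \<open>j = l\<close> bij ab by (auto simp: bij_betw_def dest: inj_onD)
  qed
  from is_min_poly_rat_scale_poly_prod[OF r0 _ this conj]
  have min: "is_min_poly_rat (scale_poly r
      (\<Prod>i\<in>totatives s \<times> {1, k}. [:- (case i of (a, j) \<Rightarrow> z8 ^ j * z ^ a), 1:])) (r * (z8 * z))"
    by simp
  have k1: "k \<noteq> 1" using q(1) by auto
  have "(\<Prod>i\<in>totatives s \<times> {1, k}. [:- (case i of (a, j) \<Rightarrow> z8 ^ j * z ^ a), 1:])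
      = (\<Prod>a\<in>totatives s. \<Prod>j\<in>{1, k}. [:- (z8 ^ j * z ^ a), 1:])"
    by (simp only: prod.cartesian_product case_prod_unfold)
  also have "\<dots> = (\<Prod>a\<in>totatives s. [:- (z8 * z ^ a), 1:] * [:- (z8 ^ k * z ^ a), 1:])"
    using k1 by (intro prod.cong refl) (simp add: prod.insert del: mult_pCons_left)
  finally show ?thesis using min by simp
qed

section \<open>The theorem\<close>

theorem theorem3p3:
  fixes p r t :: nat and q :: int and sqrtq \<zeta> \<theta> :: complex
  assumes "prime p" and "r > 0" and "odd r"
    and "q = int p ^ r \<or> q = (- int p) ^ r"
    and "t \<ge> 1"
    and "primitive_root_unity (4 * t) \<zeta>"
    and "sqrtq ^ 2 = of_int q"
    and "\<theta> = sqrtq * \<zeta>"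
  shows
    "((odd q \<and> (even t \<or> \<not> p dvd t \<or> [q = 1] (mod 4)) \<or> even q \<and> \<not> [t = 2] (mod 4)) \<longrightarrow>
        is_min_poly_rat (scale_poly sqrtq (cyclotomic_poly (4 * t))) \<theta>)
     \<and> ([q = 3] (mod 4) \<and> p dvd t \<and> odd t \<longrightarrow>
        (\<exists>sqrtqs z. sqrtqs ^ 2 = of_int (- q) \<and> primitive_root_unity t z \<and> \<theta> = sqrtqs * z) \<and>
        (\<forall>sqrtqs z. sqrtqs ^ 2 = of_int (- q) \<and> primitive_root_unity t z \<and> \<theta> = sqrtqs * z \<longrightarrow>
           is_min_poly_rat (scale_poly sqrtqs (Psi_odd p (t div p) z)) \<theta>))
     \<and> (\<forall>s. q > 0 \<and> even q \<and> t = 2 * s \<and> [t = 2] (mod 4) \<longrightarrow>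
        (\<exists>z8 z. primitive_root_unity 8 z8 \<and> primitive_root_unity s z \<and> \<zeta> = z8 * z) \<and>
        (\<forall>z8 z. primitive_root_unity 8 z8 \<and> primitive_root_unity s z \<and> \<zeta> = z8 * z \<longrightarrow>
           is_min_poly_rat (scale_poly sqrtq (Psi_two s z8 z)) \<theta>))
     \<and> (\<forall>s. q < 0 \<and> even q \<and> t = 2 * s \<and> [t = 2] (mod 4) \<longrightarrow>
        (\<exists>z8 z. primitive_root_unity 8 z8 \<and> primitive_root_unity s z \<and> \<zeta> = z8 * z) \<and>
        (\<forall>z8 z. primitive_root_unity 8 z8 \<and> primitive_root_unity s z \<and> \<zeta> = z8 * z \<longrightarrow>
           is_min_poly_rat (scale_poly sqrtq (Psi_minus_two s z8 z)) \<theta>))"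
proof -
  note \<zeta> = assms(6) and \<theta> = assms(8)
  have t: "t > 0" using assms(5) by simp
  obtain c where c: "q = int p * c\<^sup>2 \<or> q = - int p * c\<^sup>2"
    by (rule odd_prime_power_form[OF assms(3,4)])
  have q0: "q \<noteq> 0" using assms(1,4) by (auto dest: prime_gt_0_nat)
  then have s0: "sqrtq \<noteq> 0" using assms(7) by auto
  have p2: "p > 2" if "odd q"
  proof -
    have "p \<noteq> 2" using that c by auto
    then show ?thesis using prime_ge_2_nat[OF assms(1)] by simp
  qed
  have two: "p = 2" if "even q"
  proof -
    have "even p" using that assms(4) by auto
    then show ?thesis using assms(1) by (metis prime_odd_nat prime_ge_2_nat le_neq_implies_less)
  qed
  have normal: "is_min_poly_rat (scale_poly sqrtq (cyclotomic_poly (4 * t))) \<theta>"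
    if "rational_conjugate (sqrtq * \<zeta>) (- (sqrtq * \<zeta>))"
  proof -
    have "finite {z. primitive_root_unity (4 * t) z}"
      using bij_betw_finite[OF primitive_root_unity_totatives[OF \<zeta>]] by simp
    then show ?thesis
      unfolding cyclotomic_poly_def \<theta>
      by (intro is_min_poly_rat_scale_poly_prod s0 inj_on_id2
          rational_conjugates_sqrt_times_root[OF assms(7) q0 t \<zeta> that])
  qed
  have half: "odd s \<and> (\<exists>z8 z. primitive_root_unity 8 z8 \<and> primitive_root_unity s z \<and> \<zeta> = z8 * z)"
    if "t = 2 * s" "[t = 2] (mod 4)" for s
  proof -
    have s: "odd s" using that unfolding cong_def by presburger
    have "coprime (2 ^ 3) s"
      using s by (simp only: coprime_power_left_iff coprime_left_2_iff_odd) simp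
    then have "coprime 8 s" by simp
    moreover have "primitive_root_unity (8 * s) \<zeta>" using \<zeta> that(1) by simp
    ultimately show ?thesis using s by (metis primitive_root_unity_split)
  qed
  show ?thesis
  proof (intro conjI impI allI)
    assume "odd q \<and> (even t \<or> \<not> p dvd t \<or> [q = 1] (mod 4)) \<or> even q \<and> \<not> [t = 2] (mod 4)"
    then show "is_min_poly_rat (scale_poly sqrtq (cyclotomic_poly (4 * t))) \<theta>"
    proof
      assume *: "odd q \<and> (even t \<or> \<not> p dvd t \<or> [q = 1] (mod 4))"
      then show ?thesis
        using rational_conjugate_uminus_odd[OF assms(1) p2 c _ assms(7) \<zeta>] by (intro normal) blast
    next
      assume *: "even q \<and> \<not> [t = 2] (mod 4)"
      then have "q = 2 * c\<^sup>2 \<or> q = - 2 * c\<^sup>2" using c two by simp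
      then show ?thesis
        using rational_conjugate_uminus_two[OF _ assms(7) \<zeta>] * by (intro normal) blast
    qed
  next
    assume *: "[q = 3] (mod 4) \<and> p dvd t \<and> odd t"
    then have "coprime (2\<^sup>2) t"
      by (simp only: coprime_power_left_iff coprime_left_2_iff_odd) simp
    then have "coprime 4 t" by simp
    then obtain x z where xz: "primitive_root_unity 4 x" "primitive_root_unity t z" "\<zeta> = x * z"
      by (rule primitive_root_unity_split[OF _ \<zeta>])
    have "x\<^sup>2 = - 1" using primitive_root_unity_half[of 2 x] xz(1) by simp
    then have "(sqrtq * x)\<^sup>2 = of_int (- q)" using assms(7) by (simp add: power_mult_distrib)
    moreover have "\<theta> = (sqrtq * x) * z" by (simp add: \<theta> xz(3) mult.assoc)
    ultimately show "\<exists>sqrtqs z. sqrtqs\<^sup>2 = of_int (- q) \<and> primitive_root_unity t z \<and> \<theta> = sqrtqs * z"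
      using xz(2) by blast
  next
    fix sqrtqs z
    assume *: "[q = 3] (mod 4) \<and> p dvd t \<and> odd t"
      and **: "sqrtqs\<^sup>2 = of_int (- q) \<and> primitive_root_unity t z \<and> \<theta> = sqrtqs * z"
    have "q mod 4 = 3" using * by (simp add: cong_def)
    then have q: "odd q" "[- q = 1] (mod 4)" unfolding cong_def by presburger+
    have "- q = int p * c\<^sup>2 \<or> - q = - int p * c\<^sup>2" using c by auto
    then show "is_min_poly_rat (scale_poly sqrtqs (Psi_odd p (t div p) z)) \<theta>"
      using is_min_poly_rat_Psi_odd[OF assms(1) p2[OF q(1)] _ q(2)] * ** by blast
  next
    fix s assume "q > 0 \<and> even q \<and> t = 2 * s \<and> [t = 2] (mod 4)"
    then show "\<exists>z8 z. primitive_root_unity 8 z8 \<and> primitive_root_unity s z \<and> \<zeta> = z8 * z"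
      using half by blast
  next
    fix s assume "q < 0 \<and> even q \<and> t = 2 * s \<and> [t = 2] (mod 4)"
    then show "\<exists>z8 z. primitive_root_unity 8 z8 \<and> primitive_root_unity s z \<and> \<zeta> = z8 * z"
      using half by blast
  next
    fix s z8 z
    assume *: "q > 0 \<and> even q \<and> t = 2 * s \<and> [t = 2] (mod 4)"
      and **: "primitive_root_unity 8 z8 \<and> primitive_root_unity s z \<and> \<zeta> = z8 * z"
    have "z8 * z8 ^ 7 = 1"
      using primitive_root_unity_power_self[of 8 z8] ** by (simp flip: power_Suc)
    then have inv: "inverse z8 = z8 ^ 7" by (rule inverse_unique)
    have "p = 2" using two * by blast
    then have "q = 2 * c\<^sup>2" using c * by (auto simp: not_less[symmetric])
    moreover have "odd s" using half * by blast
    ultimately show "is_min_poly_rat (scale_poly sqrtq (Psi_two s z8 z)) \<theta>"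
      using is_min_poly_rat_Psi_even[OF _ q0 assms(7), of c 7 z8 s z] **
      by (simp only: Psi_two_def inv \<theta>) blast
  next
    fix s z8 z
    assume *: "q < 0 \<and> even q \<and> t = 2 * s \<and> [t = 2] (mod 4)"
      and **: "primitive_root_unity 8 z8 \<and> primitive_root_unity s z \<and> \<zeta> = z8 * z"
    have "p = 2" using two * by blast
    then have "q = - 2 * c\<^sup>2" using c * by (auto simp: not_less[symmetric])
    moreover have "odd s" using half * by blast
    ultimately show "is_min_poly_rat (scale_poly sqrtq (Psi_minus_two s z8 z)) \<theta>"
      using is_min_poly_rat_Psi_even[OF _ q0 assms(7), of c 3 z8 s z] **
      by (simp only: Psi_minus_two_def \<theta>) blast
  qed
qed

end
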